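(* Let $A,B$ be $n\times n$ positive definite matrices and let $t\in[-\tfrac12,0]\cup[1,\tfrac32]$. Then \[ A\,\widehat{sp}_t\,B\prec_{\log}A^{\frac{1-t}{2}}B^tA^{\frac{1-t}{2}}. \]
   Context: For positive definite matrices $A,B$ and $t\in\mathbb{R}$: $A\sharp B:=A^{1/2}(A^{-1/2}BA^{-1/2})^{1/2}A^{1/2}$ and $A\,\widehat{sp}_t\,B:=(A^{-1}\sharp B)^tA(A^{-1}\sharp B)^t$. For $n\times n$ positive semidefinite matrices $X,Y$ with eigenvalues $\lambda_1(\cdot)\ge\dots\ge\lambda_n(\cdot)$, $X\prec_{\log}Y$ means $\prod_{j=1}^k\lambda_j(X)\le\prod_{j=1}^k\lambda_j(Y)$ for $k=1,\dots,n-1$ and $\det X=\det Y$. *)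

theory Defs
  imports "Jordan_Normal_Form.Schur_Decomposition" "HOL-Computational_Algebra.Polynomial"
begin

definition hermitian_mat :: "complex mat \<Rightarrow> bool" where
  "hermitian_mat A \<longleftrightarrow> A \<in> carrier_mat (dim_row A) (dim_row A) \<and> mat_adjoint A = A"

definition pos_def_mat :: "complex mat \<Rightarrow> bool" where
  "pos_def_mat A \<longleftrightarrow> hermitian_mat A \<and>
     (\<forall>v \<in> carrier_vec (dim_row A). v \<noteq> 0\<^sub>v (dim_row A) \<longrightarrow>
        Im ((A *\<^sub>v v) \<bullet> conjugate v) = 0 \<and> Re ((A *\<^sub>v v) \<bullet> conjugate v) > 0)"

definition unitary_mat :: "complex mat \<Rightarrow> bool" where
  "unitary_mat U \<longleftrightarrow> U \<in> carrier_mat (dim_row U) (dim_row U) \<and>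
     U * mat_adjoint U = 1\<^sub>m (dim_row U) \<and> mat_adjoint U * U = 1\<^sub>m (dim_row U)"

definition diag_of :: "nat \<Rightarrow> (nat \<Rightarrow> complex) \<Rightarrow> complex mat" where
  "diag_of n d = mat n n (\<lambda>(i,j). if i = j then d i else 0)"

text \<open>Real power A^s of a positive definite matrix via the spectral decomposition
  A = U diag(d) U^*, A^s = U diag(d^s) U^* (independent of the chosen decomposition).\<close>
definition mat_powr :: "complex mat \<Rightarrow> real \<Rightarrow> complex mat" where
  "mat_powr A s = (SOME X. \<exists>U d. unitary_mat U \<and> dim_row U = dim_row A \<and>
      (\<forall>i < dim_row A. d i > 0) \<and>
      A = U * diag_of (dim_row A) (\<lambda>i. complex_of_real (d i)) * mat_adjoint U \<and>
      X = U * diag_of (dim_row A) (\<lambda>i. complex_of_real (d i powr s)) * mat_adjoint U)"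

definition mat_inv :: "complex mat \<Rightarrow> complex mat" where
  "mat_inv A = (SOME X. X \<in> carrier_mat (dim_row A) (dim_row A) \<and>
       A * X = 1\<^sub>m (dim_row A) \<and> X * A = 1\<^sub>m (dim_row A))"

definition geo_mean :: "complex mat \<Rightarrow> complex mat \<Rightarrow> complex mat" where
  "geo_mean A B = mat_powr A (1/2) *
      mat_powr (mat_powr A (-1/2) * B * mat_powr A (-1/2)) (1/2) * mat_powr A (1/2)"

definition sp_hat :: "real \<Rightarrow> complex mat \<Rightarrow> complex mat \<Rightarrow> complex mat" where
  "sp_hat t A B = mat_powr (geo_mean (mat_inv A) B) t * A * mat_powr (geo_mean (mat_inv A) B) t"

definition eigs :: "complex mat \<Rightarrow> real list" where
  "eigs X = (SOME L. length L = dim_row X \<and> sorted_wrt (\<ge>) L \<and>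
      char_poly X = (\<Prod>x\<leftarrow>L. [:- complex_of_real x, 1:]))"

definition log_majorized :: "complex mat \<Rightarrow> complex mat \<Rightarrow> bool" where
  "log_majorized X Y \<longleftrightarrow>
     (\<forall>k \<in> {1..dim_row X - 1}. (\<Prod>j<k. eigs X ! j) \<le> (\<Prod>j<k. eigs Y ! j)) \<and>
     det X = det Y"

end

theory Submission
  imports Defs "Jordan_Normal_Form.DL_Submatrix"
begin

text \<open>
  Put \<open>C = A\<^sup>-\<^sup>1 \<sharp> B\<close>, so that \<open>C A C = B\<close>. For \<open>t = -s \<le> 0\<close> let \<open>c\<close> be the largest eigenvalue of
  \<open>C\<^sup>-\<^sup>s A C\<^sup>-\<^sup>s\<close> and \<open>\<mu>\<close> that of \<open>B\<^bsup>-s/2\<^esup> A\<^bsup>1+s\<^esup> B\<^bsup>-s/2\<^esup>\<close>. Then \<open>A \<le> c C\<^bsup>2s\<^esup>\<close>, hence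
  \<open>B\<^sup>s = (C A C)\<^sup>s \<le> c\<^sup>s C\<^bsup>2s(1+s)\<^esup>\<close> by the Loewner-Heinz inequality, and \<open>A\<^bsup>1+s\<^esup> \<le> \<mu> B\<^sup>s\<close>. Combining
  these and applying Loewner-Heinz with exponent \<open>1/(1+s)\<close> gives \<open>A \<le> (\<mu> c\<^sup>s)\<^bsup>1/(1+s)\<^esup> C\<^bsup>2s\<^esup>\<close>, so \<open>c \<le> \<mu>\<close>
  because \<open>c\<close> is least possible. Products of the \<open>k\<close> largest eigenvalues are largest eigenvalues of
  \<open>k\<close>-th compound matrices, and compounds commute with products and real powers. The case \<open>t \<ge> 1\<close>
  is the case \<open>1 - t \<le> 0\<close> with \<open>A\<close> and \<open>B\<close> exchanged and \<open>C\<close> inverted.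
\<close>

section \<open>Unitary triangularization\<close>

lemma mat_adjoint_eq_map_transpose: "mat_adjoint A = map_mat conjugate (transpose_mat A)"
  by (rule eq_matI) (auto simp: mat_adjoint_def mat_of_rows_def)

lemma mat_adjoint_dim [simp]:
  "dim_row (mat_adjoint A) = dim_col A" "dim_col (mat_adjoint A) = dim_row A"
  by (simp_all add: mat_adjoint_eq_map_transpose)

lemma mat_adjoint_carrier [simp]: "A \<in> carrier_mat n m \<Longrightarrow> mat_adjoint A \<in> carrier_mat m n"
  by (simp add: mat_adjoint_eq_map_transpose)

lemma mat_adjoint_index [simp]:
  "i < dim_col A \<Longrightarrow> j < dim_row A \<Longrightarrow> mat_adjoint A $$ (i, j) = conjugate (A $$ (j, i))"
  by (simp add: mat_adjoint_eq_map_transpose)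

lemma mat_adjoint_adjoint [simp]: "mat_adjoint (mat_adjoint A) = A"
  by (rule eq_matI) auto

lemma mat_adjoint_mult:
  assumes "A \<in> carrier_mat n m" "B \<in> carrier_mat m k"
  shows "mat_adjoint (A * B) = mat_adjoint B * mat_adjoint A"
  using assms
  by (intro eq_matI)
    (auto simp: scalar_prod_def sum_conjugate conjugate_dist_mul mult.commute intro!: sum.cong)

lemma cscalar_prod_mat_adjoint:
  assumes "A \<in> carrier_mat n m" "v \<in> carrier_vec m" "w \<in> carrier_vec n"
  shows "(A *\<^sub>v v) \<bullet>c w = v \<bullet>c (mat_adjoint A *\<^sub>v w)"
proof -
  have "(A *\<^sub>v v) \<bullet>c w = (\<Sum>i = 0..<n. \<Sum>j = 0..<m. A $$ (i, j) * v $ j * conjugate (w $ i))"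
    using assms by (auto simp: scalar_prod_def sum_distrib_right intro!: sum.cong)
  also have "\<dots> = (\<Sum>j = 0..<m. \<Sum>i = 0..<n. A $$ (i, j) * v $ j * conjugate (w $ i))"
    by (rule sum.swap)
  also have "\<dots> = v \<bullet>c (mat_adjoint A *\<^sub>v w)"
    using assms
    by (auto simp: scalar_prod_def sum_conjugate conjugate_dist_mul sum_distrib_left ac_simps
        intro!: sum.cong)
  finally show ?thesis .
qed

lemma det_mat_adjoint:
  fixes A :: "complex mat"
  assumes "A \<in> carrier_mat n n"
  shows "det (mat_adjoint A) = cnj (det A)"
proof -
  interpret comm_ring_hom cnj by unfold_locales auto
  have "mat_adjoint A = map_mat cnj (transpose_mat A)"
    by (simp add: mat_adjoint_eq_map_transpose)
  then show ?thesis using assms by (simp add: det_transpose)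
qed

lemmas square_mult_assoc = assoc_mult_mat[of _ n n _ n _ n] for n

lemmas square_mult_carrier = mult_carrier_mat[of _ n n _ n] for n

lemmas square_mult = square_mult_assoc square_mult_carrier

lemma mat_adjoint_sandwich:
  assumes "X \<in> carrier_mat n n" "A \<in> carrier_mat n n"
  shows "mat_adjoint (mat_adjoint X * A * X) = mat_adjoint X * mat_adjoint A * X"
  using assms by (simp add: mat_adjoint_mult[where n = n and m = n and k = n] square_mult[where n = n])

lemma corthogonal_mat_normalize_columns:
  fixes W :: "complex mat"
  assumes W: "W \<in> carrier_mat n n" and orth: "corthogonal_mat W"
  obtains d :: "nat \<Rightarrow> complex"
  where "mat_adjoint (W * mat_diag n d) * (W * mat_diag n d) = 1\<^sub>m n"
proof -
  define G where "G = mat_adjoint W * W"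
  have G: "G \<in> carrier_mat n n" using W by (simp add: G_def square_mult_carrier[where n = n])
  define r where "r i = (\<Sum>k<n. (cmod (W $$ (k, i)))\<^sup>2)" for i
  have G_diag: "G $$ (i, i) = complex_of_real (r i)" if "i < n" for i
    using W that
    by (simp add: G_def r_def scalar_prod_def complex_norm_square atLeast0LessThan mult.commute
        flip: of_real_power)
  have G_offdiag: "G $$ (i, j) = 0" if "i < n" "j < n" "i \<noteq> j" for i j
    using orth that G unfolding corthogonal_mat_def diagonal_mat_def G_def Let_def by auto
  have "r i \<noteq> 0" if "i < n" for i
    using orth that W G_diag[OF that] unfolding corthogonal_mat_def G_def Let_def by auto
  then have r: "r i > 0" if "i < n" for i
    using that by (simp add: r_def sum_nonneg order_le_neq_trans)
  define D where "D = mat_diag n (\<lambda>i. complex_of_real (1 / sqrt (r i)))"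
  have D: "D \<in> carrier_mat n n" "mat_adjoint D = D"
    unfolding D_def by (auto simp: mat_diag_def)
  have "mat_adjoint (W * D) * (W * D) = D * G * D"
    using W D
    by (simp add: G_def mat_adjoint_mult[where n = n and m = n and k = n] square_mult[where n = n])
  also have "\<dots> = 1\<^sub>m n"
  proof (rule eq_matI)
    fix i j assume "i < dim_row (1\<^sub>m n :: complex mat)" "j < dim_col (1\<^sub>m n :: complex mat)"
    then have ij: "i < n" "j < n" by auto
    have "(D * G * D) $$ (i, j) = G $$ (i, j) / complex_of_real (sqrt (r i) * sqrt (r j))"
      unfolding D_def using ij G
      by (simp add: mat_diag_mult_left[OF G] mat_diag_mult_right[of _ n n])
    also have "\<dots> = 1\<^sub>m n $$ (i, j)"
      using ij G_diag[OF ij(1)] G_offdiag[OF ij] r[OF ij(1)]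
      by (cases "i = j") (auto simp flip: of_real_mult)
    finally show "(D * G * D) $$ (i, j) = 1\<^sub>m n $$ (i, j)" .
  qed (use D in auto)
  finally show ?thesis using that by (simp add: D_def)
qed

lemma corthogonal_completion:
  fixes v :: "complex vec"
  assumes v: "v \<in> carrier_vec n" "v \<noteq> 0\<^sub>v n"
  obtains W where "W \<in> carrier_mat n n" "corthogonal_mat W" "col W 0 = v"
proof -
  interpret cof_vec_space n "TYPE(complex)" .
  define b where "b = basis_completion v"
  note b = basis_completion[OF v, folded b_def]
  define ws where "ws = gram_schmidt n b"
  have ws: "set ws \<subseteq> carrier_vec n" "corthogonal ws" "length ws = n"
    using gram_schmidt_result[OF b(2,4,5) ws_def] b(6) by auto
  have "n > 0" using v by (cases n) auto
  moreover from this have "b \<noteq> []" using b(6) by auto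
  then have "b = v # tl b" using b(7) by (cases b) auto
  then have "hd ws = v" unfolding ws_def using gram_schmidt_hd[OF v(1)] by metis
  ultimately have "col (mat_of_cols n ws) 0 = v"
    using ws v(1) by (cases ws) auto
  then show ?thesis
    using that orthogonal_mat_of_cols[OF ws] mat_of_cols_carrier(1)[of n ws] ws(3) by metis
qed

lemma unitary_completion:
  fixes v :: "complex vec"
  assumes "v \<in> carrier_vec n" "v \<noteq> 0\<^sub>v n"
  obtains U c where "U \<in> carrier_mat n n" "mat_adjoint U * U = 1\<^sub>m n" "U * mat_adjoint U = 1\<^sub>m n"
    "col U 0 = c \<cdot>\<^sub>v v"
proof -
  obtain W where W: "W \<in> carrier_mat n n" "corthogonal_mat W" "col W 0 = v"
    using corthogonal_completion[OF assms] .
  obtain d where unitary: "mat_adjoint (W * mat_diag n d) * (W * mat_diag n d) = 1\<^sub>m n"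
    using corthogonal_mat_normalize_columns[OF W(1,2)] .
  have U: "W * mat_diag n d \<in> carrier_mat n n" using W(1) by simp
  have "n > 0" using assms by (cases n) auto
  then have "col (W * mat_diag n d) 0 = d 0 \<cdot>\<^sub>v v"
    using W(1,3) by (intro eq_vecI) (auto simp: mat_diag_mult_right)
  then show ?thesis
    using that[OF U unitary] mat_mult_left_right_inverse[OF mat_adjoint_carrier[OF U] U unitary]
    by blast
qed

lemma col_unitary_conjugate_eigenvector:
  fixes A :: "complex mat"
  assumes A: "A \<in> carrier_mat n n" and eigen: "A *\<^sub>v v = e \<cdot>\<^sub>v v" and v: "v \<in> carrier_vec n"
    and U: "U \<in> carrier_mat n n" "mat_adjoint U * U = 1\<^sub>m n" "col U 0 = c \<cdot>\<^sub>v v" and n: "0 < n"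
  shows "col (mat_adjoint U * A * U) 0 = e \<cdot>\<^sub>v unit_vec n 0"
proof -
  have U': "mat_adjoint U \<in> carrier_mat n n" using U(1) by simp
  have "col (mat_adjoint U * A * U) 0 = col (mat_adjoint U * (A * U)) 0"
    by (simp only: square_mult_assoc[OF U' A U(1)])
  also have "\<dots> = mat_adjoint U *\<^sub>v (A *\<^sub>v col U 0)"
    by (simp only: col_mult2[OF U' square_mult_carrier[OF A U(1)] n] col_mult2[OF A U(1) n])
  also have "A *\<^sub>v col U 0 = e \<cdot>\<^sub>v col U 0"
    unfolding U(3) using A v by (simp add: mult_mat_vec eigen smult_smult_assoc mult.commute)
  also have "mat_adjoint U *\<^sub>v (e \<cdot>\<^sub>v col U 0) = e \<cdot>\<^sub>v col (mat_adjoint U * U) 0"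
    using U(1) U' n by (simp add: mult_mat_vec[of _ n n] col_mult2[of _ n n _ n])
  finally show ?thesis using n by (simp add: U(2))
qed

lemma unitary_similarity_trans:
  assumes "similar_mat_wit A B U (mat_adjoint U)" "similar_mat_wit B C V (mat_adjoint V)"
  shows "similar_mat_wit A C (U * V) (mat_adjoint (U * V))"
proof -
  have "A \<in> carrier_mat (dim_row A) (dim_row A)" using similar_mat_witD(4)[OF refl assms(1)] .
  note A = similar_mat_witD2[OF this assms(1)]
  note B = similar_mat_witD2[OF A(5) assms(2)]
  show ?thesis using similar_mat_wit_trans[OF assms] mat_adjoint_mult[OF A(6) B(6)] by simp
qed

lemma unitary_similarity_four_block:
  fixes D :: "complex mat"
  assumes "similar_mat_wit D B V (mat_adjoint V)"
    and E: "E \<in> carrier_mat k k" and R: "R \<in> carrier_mat k m" and D: "D \<in> carrier_mat m m"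
  defines "W \<equiv> four_block_mat (1\<^sub>m k) (0\<^sub>m k m) (0\<^sub>m m k) V"
  shows "similar_mat_wit (four_block_mat E R (0\<^sub>m m k) D) (four_block_mat E (R * V) (0\<^sub>m m k) B)
    W (mat_adjoint W)"
proof -
  note V = similar_mat_witD2[OF D assms(1)]
  have "mat_adjoint W = four_block_mat (1\<^sub>m k) (0\<^sub>m k m) (0\<^sub>m m k) (mat_adjoint V)"
    unfolding W_def using V by (intro eq_matI) auto
  moreover have "similar_mat_wit (four_block_mat E R (0\<^sub>m m k) D) (four_block_mat E (R * V) (0\<^sub>m m k) B)
      W (four_block_mat (1\<^sub>m k) (0\<^sub>m k m) (0\<^sub>m m k) (mat_adjoint V))"
    unfolding W_def
  proof (rule similar_mat_wit_four_block[OF similar_mat_wit_refl[OF E] assms(1) _ _ E D])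
    show "R = 1\<^sub>m k * (R * V) * mat_adjoint V" using R V by (simp add: assoc_mult_mat[of _ k m _ m _ m])
  qed (use R V in auto)
  ultimately show ?thesis by simp
qed

text \<open>In an orthonormal basis that begins with an eigenvector, the first column below the diagonal
  vanishes.\<close>

lemma unitary_deflation:
  fixes A :: "complex mat"
  assumes A: "A \<in> carrier_mat (Suc m) (Suc m)" and "eigenvalue A e"
  obtains U R D where "R \<in> carrier_mat 1 m" "D \<in> carrier_mat m m"
    "similar_mat_wit A (four_block_mat (mat 1 1 (\<lambda>_. e)) R (0\<^sub>m m 1) D) U (mat_adjoint U)"
proof -
  obtain v where v: "v \<in> carrier_vec (Suc m)" "v \<noteq> 0\<^sub>v (Suc m)" and eigen: "A *\<^sub>v v = e \<cdot>\<^sub>v v"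
    using assms unfolding eigenvalue_def eigenvector_def by auto
  obtain U c where U: "U \<in> carrier_mat (Suc m) (Suc m)" "mat_adjoint U * U = 1\<^sub>m (Suc m)"
    "U * mat_adjoint U = 1\<^sub>m (Suc m)" "col U 0 = c \<cdot>\<^sub>v v"
    using unitary_completion[OF v] .
  define B where "B = mat_adjoint U * A * U"
  have B: "B \<in> carrier_mat (Suc m) (Suc m)"
    using A U(1) by (simp add: B_def square_mult_carrier[where n = "Suc m"])
  have "similar_mat_wit B A (mat_adjoint U) U"
    using A B U by (intro similar_mat_witI[of _ _ "Suc m"]) (auto simp: B_def)
  then have AB: "similar_mat_wit A B U (mat_adjoint U)" by (rule similar_mat_wit_sym)
  have first_col: "B $$ (i, 0) = (if i = 0 then e else 0)" if "i < Suc m" for i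
    using arg_cong[OF col_unitary_conjugate_eigenvector[OF A eigen v(1) U(1,2,4)], of "\<lambda>u. u $ i"]
      B that
    by (auto simp: B_def unit_vec_def)
  obtain E R Z D where split: "split_block B 1 1 = (E, R, Z, D)" by (cases "split_block B 1 1")
  then have "E = mat 1 1 (\<lambda>_. e)" "Z = 0\<^sub>m m 1"
    using B first_col by (auto simp: split_block_def Let_def intro!: eq_matI)
  with split_block[OF split, of m m] B show ?thesis using that AB by auto
qed

lemma char_poly_four_block_eigenvalue:
  fixes D :: "'a :: idom mat"
  assumes "R \<in> carrier_mat 1 m" "D \<in> carrier_mat m m"
  shows "char_poly (four_block_mat (mat 1 1 (\<lambda>_. e)) R (0\<^sub>m m 1) D) = [:- e, 1:] * char_poly D"
  using char_poly_four_block_zeros_col[OF _ assms, of "mat 1 1 (\<lambda>_. e)"]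
  by (simp add: char_poly_defs det_def sign_def)

theorem unitary_schur:
  fixes A :: "complex mat"
  assumes "A \<in> carrier_mat n n" "char_poly A = (\<Prod>e\<leftarrow>es. [:- e, 1:])"
  shows "\<exists>U B. similar_mat_wit A B U (mat_adjoint U) \<and> upper_triangular B \<and> diag_mat B = es"
  using assms
proof (induction es arbitrary: n A)
  case Nil
  then have "n = 0" using degree_monic_char_poly[of A n] by auto
  then have "mat_adjoint (1\<^sub>m n :: complex mat) = 1\<^sub>m n" by (intro eq_matI) auto
  then have "similar_mat_wit A A (1\<^sub>m n) (mat_adjoint (1\<^sub>m n))"
    using similar_mat_wit_refl[OF Nil(1)] by simp
  moreover have "upper_triangular A" "diag_mat A = []"
    using Nil(1) \<open>n = 0\<close> by (auto simp: diag_mat_def)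
  ultimately show ?case by blast
next
  case (Cons e es)
  note A = Cons.prems(1) and char_poly_A = Cons.prems(2)
  have "eigenvalue A e" unfolding eigenvalue_root_char_poly[OF A] char_poly_A by simp
  moreover obtain m where "n = Suc m"
    using degree_monic_char_poly[OF A] degree_linear_factors[of uminus "e # es"] char_poly_A by (cases n) auto
  ultimately obtain U R D where R: "R \<in> carrier_mat 1 m" and D: "D \<in> carrier_mat m m"
    and deflated: "similar_mat_wit A (four_block_mat (mat 1 1 (\<lambda>_. e)) R (0\<^sub>m m 1) D) U (mat_adjoint U)"
    using unitary_deflation A by metis
  define E where "E = mat 1 1 (\<lambda>_. e)"
  have E: "E \<in> carrier_mat 1 1" by (simp add: E_def)
  have "[:- e, 1:] * (\<Prod>e\<leftarrow>es. [:- e, 1:]) = char_poly (four_block_mat E R (0\<^sub>m m 1) D)"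
    using char_poly_A char_poly_similar deflated unfolding similar_mat_def E_def by fastforce
  also have "\<dots> = [:- e, 1:] * char_poly D"
    unfolding E_def by (rule char_poly_four_block_eigenvalue[OF R D])
  finally have "char_poly D = (\<Prod>e\<leftarrow>es. [:- e, 1:])"
    by (metis mult_cancel_left pCons_eq_0_iff zero_neq_one)
  from Cons.IH[OF D this] obtain V B where V: "similar_mat_wit D B V (mat_adjoint V)"
    and B: "upper_triangular B" "diag_mat B = es" by blast
  have B_carrier: "B \<in> carrier_mat m m" using similar_mat_witD2[OF D V] by blast
  have "upper_triangular (four_block_mat E (R * V) (0\<^sub>m m 1) B)"
    using B_carrier B(1) by (intro upper_triangular_four_block[OF E]) (auto simp: E_def)
  moreover have "diag_mat (four_block_mat E (R * V) (0\<^sub>m m 1) B) = e # es"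
    using diag_four_block_mat[OF E B_carrier] B(2) by (simp add: E_def diag_mat_def)
  ultimately show ?case
    using unitary_similarity_trans[OF deflated[folded E_def] unitary_similarity_four_block[OF V E R D]]
    by blast
qed

section \<open>Spectral decompositions\<close>

abbreviation real_diag :: "nat \<Rightarrow> (nat \<Rightarrow> real) \<Rightarrow> complex mat" where
  "real_diag n d \<equiv> mat_diag n (\<lambda>i. complex_of_real (d i))"

definition spectral_decomp :: "nat \<Rightarrow> complex mat \<Rightarrow> complex mat \<Rightarrow> (nat \<Rightarrow> real) \<Rightarrow> bool" where
  "spectral_decomp n A U d \<longleftrightarrow>
     A \<in> carrier_mat n n \<and> similar_mat_wit A (real_diag n d) U (mat_adjoint U)"

lemma dim_mat_diag [simp]: "dim_row (mat_diag n d) = n" "dim_col (mat_diag n d) = n"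
  by (simp_all add: mat_diag_def)

lemma mat_adjoint_real_diag [simp]: "mat_adjoint (real_diag n d) = real_diag n d"
  by (rule eq_matI) (auto simp: mat_diag_def)

lemma mat_diag_cong: "(\<And>i. i < n \<Longrightarrow> d i = e i) \<Longrightarrow> mat_diag n d = mat_diag n e"
  by (rule eq_matI) (auto simp: mat_diag_def)

lemma spectral_decompI:
  assumes "U \<in> carrier_mat n n" "U * mat_adjoint U = 1\<^sub>m n" "mat_adjoint U * U = 1\<^sub>m n"
    "A = U * real_diag n d * mat_adjoint U"
  shows "spectral_decomp n A U d"
  using assms unfolding spectral_decomp_def
  by (auto intro!: similar_mat_witI[of _ _ n] square_mult_carrier)

lemma spectral_decompD:
  assumes "spectral_decomp n A U d"
  shows "U \<in> carrier_mat n n" "mat_adjoint U \<in> carrier_mat n n" "U * mat_adjoint U = 1\<^sub>m n"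
    "mat_adjoint U * U = 1\<^sub>m n" "A = U * real_diag n d * mat_adjoint U" "A \<in> carrier_mat n n"
  using similar_mat_witD2[of A n n "real_diag n d" U "mat_adjoint U"] assms
  by (simp_all add: spectral_decomp_def)

lemma hermitian_mat_iff:
  assumes "A \<in> carrier_mat n n"
  shows "hermitian_mat A \<longleftrightarrow> mat_adjoint A = A"
  using assms by (auto simp: hermitian_mat_def)

lemma hermitian_upper_triangular:
  assumes B: "B \<in> carrier_mat n n" and "hermitian_mat B" and "upper_triangular B"
  shows "B = real_diag n (\<lambda>i. Re (B $$ (i, i)))"
proof (rule eq_matI)
  fix i j
  assume "i < dim_row (real_diag n (\<lambda>i. Re (B $$ (i, i))))"
    "j < dim_col (real_diag n (\<lambda>i. Re (B $$ (i, i))))"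
  then have ij: "i < n" "j < n" by (auto simp: mat_diag_def)
  have "mat_adjoint B $$ (i, j) = B $$ (i, j)" using assms by (simp add: hermitian_mat_def)
  then have "B $$ (i, j) = cnj (B $$ (j, i))" using ij B by simp
  then show "B $$ (i, j) = real_diag n (\<lambda>i. Re (B $$ (i, i))) $$ (i, j)"
    using ij B upper_triangularD[OF assms(3), of i j] upper_triangularD[OF assms(3), of j i]
    by (cases i j rule: linorder_cases) (auto simp: mat_diag_def complex_eq_iff)
qed (use B in \<open>auto simp: mat_diag_def\<close>)

theorem hermitian_spectral_decomp:
  assumes A: "A \<in> carrier_mat n n" and herm: "hermitian_mat A"
    and char_poly: "char_poly A = (\<Prod>e\<leftarrow>es. [:- e, 1:])"
  shows "set es \<subseteq> \<real>" "\<exists>U. spectral_decomp n A U (\<lambda>i. Re (es ! i))"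
proof -
  obtain U B where AB: "similar_mat_wit A B U (mat_adjoint U)"
    and B: "upper_triangular B" "diag_mat B = es"
    using unitary_schur[OF A char_poly] by blast
  note U = similar_mat_witD2[OF A AB]
  have "B = mat_adjoint U * A * U"
    by (rule similar_mat_witD(3)[OF refl similar_mat_wit_sym[OF AB]])
  then have "hermitian_mat B"
    using mat_adjoint_sandwich[OF U(6) A] herm A U(5) by (simp add: hermitian_mat_iff)
  note diag = hermitian_upper_triangular[OF U(5) this B(1)]
  have es: "length es = n" "\<And>i. i < n \<Longrightarrow> es ! i = B $$ (i, i)"
    using U(5) B(2) by (auto simp: diag_mat_def)
  have real: "B $$ (i, i) = complex_of_real (Re (B $$ (i, i)))" if "i < n" for i
    using arg_cong[OF diag, of "\<lambda>M. M $$ (i, i)"] that by (simp add: mat_diag_def)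
  then show "set es \<subseteq> \<real>"
    using es by (metis Reals_of_real in_set_conv_nth subsetI)
  have "B = real_diag n (\<lambda>i. Re (es ! i))"
    by (subst diag) (rule mat_diag_cong, simp add: es)
  then show "\<exists>U. spectral_decomp n A U (\<lambda>i. Re (es ! i))"
    using A AB by (auto simp: spectral_decomp_def)
qed

lemma eigs_hermitian:
  assumes A: "A \<in> carrier_mat n n" and "hermitian_mat A"
  shows "length (eigs A) = n" "sorted_wrt (\<ge>) (eigs A)"
    "char_poly A = (\<Prod>x\<leftarrow>eigs A. [:- complex_of_real x, 1:])"
proof -
  obtain as where as: "char_poly A = (\<Prod>a\<leftarrow>as. [:- a, 1:])" "length as = n"
    using char_poly_factorized[OF A] by blast
  have real: "complex_of_real (Re a) = a" if "a \<in> set as" for a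
    using subsetD[OF hermitian_spectral_decomp(1)[OF assms as(1)] that] by (rule of_real_Re)
  define L where "L = rev (sort (map Re as))"
  have "mset (map complex_of_real L) = mset as"
    unfolding L_def using image_mset_cong[of "mset as" "\<lambda>a. complex_of_real (Re a)" id] real
    by (simp add: image_mset.compositionality o_def)
  then have "mset (map (\<lambda>x. [:- x, 1:]) (map complex_of_real L)) = mset (map (\<lambda>a. [:- a, 1:]) as)"
    by (simp only: mset_map)
  then have "(\<Prod>x\<leftarrow>map complex_of_real L. [:- x, 1:]) = (\<Prod>a\<leftarrow>as. [:- a, 1:])"
    by (metis prod_mset_prod_list)
  then have "length L = dim_row A \<and> sorted_wrt (\<ge>) L \<and>
      char_poly A = (\<Prod>x\<leftarrow>L. [:- complex_of_real x, 1:])"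
    using A as by (simp add: L_def sorted_wrt_rev o_def)
  from someI[of "\<lambda>L. length L = dim_row A \<and> sorted_wrt (\<ge>) L \<and>
      char_poly A = (\<Prod>x\<leftarrow>L. [:- complex_of_real x, 1:])", OF this]
  show "length (eigs A) = n" "sorted_wrt (\<ge>) (eigs A)"
    "char_poly A = (\<Prod>x\<leftarrow>eigs A. [:- complex_of_real x, 1:])"
    using A by (simp_all add: eigs_def)
qed

lemma eigs_antimono:
  assumes "A \<in> carrier_mat n n" "hermitian_mat A" "i \<le> j" "j < n"
  shows "eigs A ! j \<le> eigs A ! i"
  using eigs_hermitian(1,2)[OF assms(1,2)] assms(3,4)
  by (cases "i = j") (auto simp: sorted_wrt_iff_nth_less)

lemma hermitian_spectral_decomp_eigs:
  assumes "A \<in> carrier_mat n n" "hermitian_mat A"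
  obtains U where "spectral_decomp n A U ((!) (eigs A))"
proof -
  have "char_poly A = (\<Prod>e\<leftarrow>map complex_of_real (eigs A). [:- e, 1:])"
    using eigs_hermitian(3)[OF assms] by (simp add: o_def)
  from hermitian_spectral_decomp(2)[OF assms this] obtain U
    where "spectral_decomp n A U (\<lambda>i. Re (map complex_of_real (eigs A) ! i))" by blast
  moreover have "real_diag n (\<lambda>i. Re (map complex_of_real (eigs A) ! i)) = real_diag n ((!) (eigs A))"
    by (rule mat_diag_cong) (simp add: eigs_hermitian(1)[OF assms])
  ultimately have "spectral_decomp n A U ((!) (eigs A))" by (simp only: spectral_decomp_def)
  then show ?thesis by (rule that)
qed

lemma spectral_decomp_one:
  assumes "spectral_decomp n A U d"
  shows "spectral_decomp n (1\<^sub>m n) U (\<lambda>_. 1)"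
  using spectral_decompD[OF assms] by (intro spectral_decompI) auto

lemma spectral_decomp_mult:
  assumes "spectral_decomp n A U d" "spectral_decomp n B U e"
  shows "spectral_decomp n (A * B) U (\<lambda>i. d i * e i)"
proof (rule spectral_decompI)
  note A = spectral_decompD[OF assms(1)] and B = spectral_decompD[OF assms(2)]
  show "U \<in> carrier_mat n n" "U * mat_adjoint U = 1\<^sub>m n" "mat_adjoint U * U = 1\<^sub>m n"
    using A by simp_all
  have "A * B = U * (real_diag n d * (mat_adjoint U * U) * real_diag n e) * mat_adjoint U"
    unfolding A(5) B(5) using A(1,2) by (simp add: square_mult[where n = n])
  then show "A * B = U * real_diag n (\<lambda>i. d i * e i) * mat_adjoint U"
    by (simp add: A(4) right_mult_one_mat[of _ n n])
qed

lemma spectral_decomp_smult: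
  assumes "spectral_decomp n A U d"
  shows "spectral_decomp n (complex_of_real c \<cdot>\<^sub>m A) U (\<lambda>i. c * d i)"
proof (rule spectral_decompI)
  note U = spectral_decompD[OF assms]
  show "U \<in> carrier_mat n n" "U * mat_adjoint U = 1\<^sub>m n" "mat_adjoint U * U = 1\<^sub>m n"
    using U by simp_all
  have "real_diag n (\<lambda>i. c * d i) = complex_of_real c \<cdot>\<^sub>m real_diag n d"
    by (rule eq_matI) (auto simp: mat_diag_def)
  then show "complex_of_real c \<cdot>\<^sub>m A = U * real_diag n (\<lambda>i. c * d i) * mat_adjoint U"
    unfolding U(5) using U(1,2)
    by (simp add: mult_smult_distrib[of _ n n _ n] mult_smult_assoc_mat[of _ n n _ n]
        square_mult_carrier[where n = n])
qed

lemma det_mat_diag: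
  fixes d :: "nat \<Rightarrow> 'a :: comm_ring_1"
  shows "det (mat_diag n d) = (\<Prod>i<n. d i)"
  by (subst det_upper_triangular[of _ n]) (auto simp: prod_list_diag_prod mat_diag_def atLeast0LessThan)

lemma spectral_decomp_det:
  assumes "spectral_decomp n A U d"
  shows "det A = complex_of_real (\<Prod>i<n. d i)"
proof -
  have "similar_mat A (real_diag n d)"
    using assms unfolding spectral_decomp_def similar_mat_def by blast
  then have "det A = det (real_diag n d)" by (rule det_similar)
  then show ?thesis by (simp add: det_mat_diag)
qed

lemma mat_diag_intertwine:
  fixes W :: "'a :: idom mat"
  assumes W: "W \<in> carrier_mat n n" and "mat_diag n e * W = W * mat_diag n d"
  shows "mat_diag n (\<lambda>i. f (e i)) * W = W * mat_diag n (\<lambda>i. f (d i))"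
proof (rule eq_matI)
  fix i j
  assume "i < dim_row (W * mat_diag n (\<lambda>i. f (d i)))" "j < dim_col (W * mat_diag n (\<lambda>i. f (d i)))"
  then have ij: "i < n" "j < n" using W by (auto simp: mat_diag_def)
  have "e i * W $$ (i, j) = W $$ (i, j) * d j"
    using arg_cong[OF assms(2), of "\<lambda>M. M $$ (i, j)"] ij
    by (simp add: mat_diag_mult_left[OF W] mat_diag_mult_right[OF W])
  then have "W $$ (i, j) = 0 \<or> e i = d j" by (simp add: mult.commute)
  then show "(mat_diag n (\<lambda>i. f (e i)) * W) $$ (i, j) = (W * mat_diag n (\<lambda>i. f (d i))) $$ (i, j)"
    using ij by (auto simp: mat_diag_mult_left[OF W] mat_diag_mult_right[OF W])
qed (use W in \<open>auto simp: mat_diag_def\<close>)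

lemma spectral_decomp_intertwine:
  assumes "spectral_decomp n A U d"
  shows "A * U = U * real_diag n d" "mat_adjoint U * A = real_diag n d * mat_adjoint U"
proof -
  note U = spectral_decompD[OF assms]
  have "A * U = U * real_diag n d * (mat_adjoint U * U)"
    unfolding U(5) using U(1,2) by (simp add: square_mult[where n = n])
  then show "A * U = U * real_diag n d"
    using U(1) by (simp add: U(4) right_mult_one_mat[of _ n n] square_mult_carrier[where n = n])
  have "mat_adjoint U * A = (mat_adjoint U * U) * real_diag n d * mat_adjoint U"
    unfolding U(5) using U(1,2) by (simp add: square_mult[where n = n])
  then show "mat_adjoint U * A = real_diag n d * mat_adjoint U"
    by (simp add: U(4) left_mult_one_mat[of _ n n])
qed

lemma functional_calculus_unique:
  assumes "spectral_decomp n A U d" "spectral_decomp n A V e"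
    and X: "spectral_decomp n X U (\<lambda>i. f (d i))" and Y: "spectral_decomp n Y V (\<lambda>i. f (e i))"
  shows "X = Y"
proof -
  note U = spectral_decompD[OF X] and V = spectral_decompD[OF Y]
  define W where "W = mat_adjoint V * U"
  have W: "W \<in> carrier_mat n n" unfolding W_def by (rule square_mult_carrier[OF V(2) U(1)])
  have "real_diag n e * W = mat_adjoint V * A * U"
    unfolding W_def spectral_decomp_intertwine(2)[OF assms(2)]
    using U(1) V(2) by (simp add: square_mult[where n = n])
  also have "\<dots> = W * real_diag n d"
    unfolding W_def using U(1) V(2) spectral_decompD(6)[OF assms(1)]
    by (simp add: square_mult[where n = n] spectral_decomp_intertwine(1)[OF assms(1)])
  finally have "real_diag n e * W = W * real_diag n d" .
  from mat_diag_intertwine[OF W this, of "\<lambda>z. complex_of_real (f (Re z))"]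
  have W_intertwines: "real_diag n (\<lambda>i. f (e i)) * W = W * real_diag n (\<lambda>i. f (d i))" by simp
  have "Y * U = V * (real_diag n (\<lambda>i. f (e i)) * W)"
    unfolding V(5) W_def using U(1) V(1,2) by (simp add: square_mult[where n = n])
  also have "\<dots> = (V * mat_adjoint V) * U * real_diag n (\<lambda>i. f (d i))"
    unfolding W_intertwines unfolding W_def using U(1) V(1,2) by (simp add: square_mult[where n = n])
  also have "\<dots> = U * real_diag n (\<lambda>i. f (d i))" using U(1) V(3) by simp
  finally have "Y * (U * mat_adjoint U) = X"
    unfolding U(5) using U(1,2) V(6) by (simp flip: square_mult_assoc[where n = n])
  then show ?thesis using U(3) V(6) by simp
qed

lemma spectral_decomp_unique:
  assumes "spectral_decomp n A U d" "spectral_decomp n B U e" "\<And>i. i < n \<Longrightarrow> d i = e i"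
  shows "A = B"
proof -
  have "real_diag n d = real_diag n e" by (rule mat_diag_cong) (simp add: assms(3))
  then show ?thesis using spectral_decompD(5)[OF assms(1)] spectral_decompD(5)[OF assms(2)] by simp
qed

lemma spectral_decomp_col:
  assumes A: "spectral_decomp n A U d" and i: "i < n"
  shows "col U i \<in> carrier_vec n" "col U i \<bullet>c col U i = 1"
    "A *\<^sub>v col U i = complex_of_real (d i) \<cdot>\<^sub>v col U i"
proof -
  note U = spectral_decompD[OF A]
  show "col U i \<in> carrier_vec n" using U(1) i by simp
  have "col U i \<bullet>c col U i = (mat_adjoint U * U) $$ (i, i)"
    using U(1) i by (auto simp: scalar_prod_def mult.commute intro!: sum.cong)
  then show "col U i \<bullet>c col U i = 1" using U(4) i by simp
  have "A *\<^sub>v col U i = col (U * real_diag n d) i"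
    using col_mult2[OF U(6,1) i] by (simp add: spectral_decomp_intertwine(1)[OF A])
  also have "\<dots> = complex_of_real (d i) \<cdot>\<^sub>v col U i"
    using U(1) i by (intro eq_vecI) (auto simp: mat_diag_mult_right)
  finally show "A *\<^sub>v col U i = complex_of_real (d i) \<cdot>\<^sub>v col U i" .
qed

section \<open>Positive definite matrices and their real powers\<close>

definition posdef :: "nat \<Rightarrow> complex mat \<Rightarrow> bool" where
  "posdef n A \<longleftrightarrow> A \<in> carrier_mat n n \<and> pos_def_mat A"

definition quad_form :: "complex mat \<Rightarrow> complex vec \<Rightarrow> real" where
  "quad_form A v = Re ((A *\<^sub>v v) \<bullet>c v)"

lemma cscalar_prod_eq_quad_form:
  assumes "A \<in> carrier_mat n n" "hermitian_mat A" "v \<in> carrier_vec n"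
  shows "(A *\<^sub>v v) \<bullet>c v = complex_of_real (quad_form A v)"
proof -
  have Av: "A *\<^sub>v v \<in> carrier_vec n" using assms by simp
  have "(A *\<^sub>v v) \<bullet>c v = v \<bullet>c (A *\<^sub>v v)"
    using cscalar_prod_mat_adjoint[OF assms(1,3,3)] assms(2) by (simp add: hermitian_mat_def)
  also have "\<dots> = cnj ((A *\<^sub>v v) \<bullet>c v)"
    using conjugate_conjugate_sprod[OF assms(3) Av] conjugate_vec_sprod_comm[OF Av assms(3)] by simp
  finally have "Im ((A *\<^sub>v v) \<bullet>c v) = 0" by (metis cnj.sel(2) equal_neg_zero)
  then show ?thesis by (simp add: quad_form_def complex_eq_iff)
qed

lemma posdef_iff:
  "posdef n A \<longleftrightarrow> A \<in> carrier_mat n n \<and> hermitian_mat A \<and>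
     (\<forall>v \<in> carrier_vec n. v \<noteq> 0\<^sub>v n \<longrightarrow> quad_form A v > 0)"
proof (cases "A \<in> carrier_mat n n \<and> hermitian_mat A")
  case True
  then have "Im ((A *\<^sub>v v) \<bullet>c v) = 0" if "v \<in> carrier_vec n" for v
    using cscalar_prod_eq_quad_form[OF _ _ that, of A] by simp
  moreover have "dim_row A = n" using True by auto
  ultimately show ?thesis
    using True by (simp add: posdef_def pos_def_mat_def quad_form_def)
qed (auto simp: posdef_def pos_def_mat_def)

lemma posdefD:
  assumes "posdef n A"
  shows "A \<in> carrier_mat n n" "hermitian_mat A" "mat_adjoint A = A"
    "v \<in> carrier_vec n \<Longrightarrow> v \<noteq> 0\<^sub>v n \<Longrightarrow> quad_form A v > 0"
  using assms by (auto simp: posdef_iff hermitian_mat_def)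

lemma posdef_mult_vec_nonzero:
  assumes "posdef n A" "v \<in> carrier_vec n" "v \<noteq> 0\<^sub>v n"
  shows "A *\<^sub>v v \<noteq> 0\<^sub>v n"
proof
  assume "A *\<^sub>v v = 0\<^sub>v n"
  then have "quad_form A v = 0" using assms(2) by (simp add: quad_form_def)
  then show False using posdefD(4)[OF assms] by simp
qed

lemma quad_form_one_pos:
  assumes "v \<in> carrier_vec n" "v \<noteq> 0\<^sub>v n"
  shows "quad_form (1\<^sub>m n) v > 0"
  using conjugate_square_greater_0_vec[OF assms(1)] assms
  by (simp add: quad_form_def less_complex_def)

lemma quad_form_smult:
  assumes "A \<in> carrier_mat n n" "v \<in> carrier_vec n"
  shows "quad_form (complex_of_real c \<cdot>\<^sub>m A) v = c * quad_form A v"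
proof -
  have "(complex_of_real c \<cdot>\<^sub>m A) *\<^sub>v v = complex_of_real c \<cdot>\<^sub>v (A *\<^sub>v v)"
    using assms by (intro eq_vecI) auto
  then show ?thesis using assms by (simp add: quad_form_def)
qed

lemma quad_form_congruence:
  assumes "A \<in> carrier_mat n n" "X \<in> carrier_mat n n" "v \<in> carrier_vec n"
  shows "quad_form (mat_adjoint X * A * X) v = quad_form A (X *\<^sub>v v)"
proof -
  have X': "mat_adjoint X \<in> carrier_mat n n" using assms by simp
  have AXv: "A *\<^sub>v (X *\<^sub>v v) \<in> carrier_vec n" using assms by simp
  have "(mat_adjoint X * A * X) *\<^sub>v v = mat_adjoint X *\<^sub>v (A *\<^sub>v (X *\<^sub>v v))"
    using assms X' by (simp add: square_mult[where n = n] assoc_mult_mat_vec[of _ n n _ n])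
  then show ?thesis
    using cscalar_prod_mat_adjoint[OF X' AXv assms(3)] by (simp add: quad_form_def)
qed

lemma quad_form_real_diag:
  assumes "v \<in> carrier_vec n"
  shows "quad_form (real_diag n d) v = (\<Sum>i<n. d i * (cmod (v $ i))\<^sup>2)"
proof -
  have "(real_diag n d *\<^sub>v v) $ i = complex_of_real (d i) * v $ i" if "i < n" for i
    using that assms
    by (simp add: mat_diag_def scalar_prod_def atLeast0LessThan if_distrib[of "\<lambda>x. x * _"]
        cong: if_cong)
  then have "(real_diag n d *\<^sub>v v) \<bullet>c v = (\<Sum>i<n. complex_of_real (d i) * (v $ i * cnj (v $ i)))"
    using assms by (simp add: scalar_prod_def atLeast0LessThan mult.assoc del: index_mult_mat_vec)
  also have "\<dots> = complex_of_real (\<Sum>i<n. d i * (cmod (v $ i))\<^sup>2)"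
    by (simp add: complex_norm_square flip: of_real_power)
  finally show ?thesis by (simp add: quad_form_def)
qed

lemma quad_form_spectral:
  assumes "spectral_decomp n A U d" "v \<in> carrier_vec n"
  shows "quad_form A v = (\<Sum>i<n. d i * (cmod ((mat_adjoint U *\<^sub>v v) $ i))\<^sup>2)"
proof -
  note U = spectral_decompD[OF assms(1)]
  have "quad_form A v = quad_form (real_diag n d) (mat_adjoint U *\<^sub>v v)"
    using quad_form_congruence[OF mat_diag_dim U(2) assms(2)] U(5) by simp
  also have "\<dots> = (\<Sum>i<n. d i * (cmod ((mat_adjoint U *\<^sub>v v) $ i))\<^sup>2)"
    using U(2) assms(2) by (intro quad_form_real_diag) simp
  finally show ?thesis .
qed

lemma spectral_decomp_quad_form_col:
  assumes "spectral_decomp n A U d" "i < n"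
  shows "quad_form A (col U i) = d i"
  using spectral_decomp_col[OF assms] by (simp add: quad_form_def)

lemma spectral_decomp_posdef:
  assumes A: "spectral_decomp n A U d" and d_pos: "\<And>i. i < n \<Longrightarrow> d i > 0"
  shows "posdef n A"
proof -
  note U = spectral_decompD[OF A]
  have "mat_adjoint A = A"
    unfolding U(5) using mat_adjoint_sandwich[OF U(2), of "real_diag n d"] by simp
  moreover have "quad_form A v > 0" if v: "v \<in> carrier_vec n" "v \<noteq> 0\<^sub>v n" for v
  proof -
    let ?w = "mat_adjoint U *\<^sub>v v"
    have "(\<Sum>i<n. 1 * (cmod (?w $ i))\<^sup>2) > 0"
      using quad_form_spectral[OF spectral_decomp_one[OF A] v(1)] quad_form_one_pos[OF v] by simp
    then obtain i where i: "i < n" "?w $ i \<noteq> 0"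
      by (metis (no_types, lifting) lessThan_iff less_irrefl mult_eq_0_iff norm_zero sum.neutral
          zero_power2)
    show ?thesis
      unfolding quad_form_spectral[OF A v(1)]
    proof (rule sum_pos2[of _ i])
      show "0 < d i * (cmod (?w $ i))\<^sup>2" using i d_pos[OF i(1)] by simp
    qed (use i d_pos in \<open>auto simp: less_imp_le simp del: index_mult_mat_vec\<close>)
  qed
  ultimately show ?thesis using U(6) by (simp add: posdef_iff hermitian_mat_iff)
qed

lemma posdef_spectral_decomp_eigs:
  assumes "posdef n A"
  obtains U where "spectral_decomp n A U ((!) (eigs A))" "\<And>i. i < n \<Longrightarrow> eigs A ! i > 0"
proof -
  note A = posdefD[OF assms]
  obtain U where U: "spectral_decomp n A U ((!) (eigs A))"
    using hermitian_spectral_decomp_eigs[OF A(1,2)] .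
  have "eigs A ! i > 0" if i: "i < n" for i
  proof -
    have "col U i \<noteq> 0\<^sub>v n" using spectral_decomp_col(1,2)[OF U i] by auto
    then show ?thesis
      using A(4)[OF spectral_decomp_col(1)[OF U i]] spectral_decomp_quad_form_col[OF U i] by simp
  qed
  then show ?thesis using U that by blast
qed

lemma posdef_congruence:
  assumes H: "posdef n H" and A: "posdef n A"
  shows "posdef n (H * A * H)"
proof -
  note H' = posdefD[OF H] and A' = posdefD[OF A]
  have "quad_form (H * A * H) v > 0" if v: "v \<in> carrier_vec n" "v \<noteq> 0\<^sub>v n" for v
    using quad_form_congruence[OF A'(1) H'(1) v(1)] posdef_mult_vec_nonzero[OF H v] A'(4) H'(1,3) v(1)
    by simp
  then show ?thesis
    using mat_adjoint_sandwich[OF H'(1) A'(1)] H'(1,3) A'(1,3)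
    by (simp add: posdef_iff hermitian_mat_iff[where n = n] square_mult_carrier)
qed

lemma diag_of_eq_mat_diag: "diag_of n d = mat_diag n d"
  by (rule eq_matI) (auto simp: diag_of_def mat_diag_def)

lemma spectral_decomp_iff_unitary_mat:
  "spectral_decomp n A U d \<longleftrightarrow> unitary_mat U \<and> dim_row U = n \<and>
     A = U * diag_of n (\<lambda>i. complex_of_real (d i)) * mat_adjoint U"
  unfolding diag_of_eq_mat_diag unitary_mat_def
  using spectral_decompD[of n A U d] spectral_decompI[of U n A d] by fastforce

lemma spectral_decomp_mat_powr:
  assumes A: "spectral_decomp n A U d" and d_pos: "\<And>i. i < n \<Longrightarrow> d i > 0"
  shows "spectral_decomp n (mat_powr A s) U (\<lambda>i. d i powr s)"
proof -
  define powr_witness where "powr_witness X \<longleftrightarrow> (\<exists>V e. spectral_decomp n A V e \<and> (\<forall>i<n. e i > 0) \<and>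
    spectral_decomp n X V (\<lambda>i. e i powr s))" for X
  have "dim_row A = n" using spectral_decompD(6)[OF A] by simp
  then have "mat_powr A s = (SOME X. powr_witness X)"
    unfolding mat_powr_def powr_witness_def spectral_decomp_iff_unitary_mat
    by (intro arg_cong[of _ _ Eps] ext) metis
  moreover define X where "X = U * real_diag n (\<lambda>i. d i powr s) * mat_adjoint U"
  have X: "spectral_decomp n X U (\<lambda>i. d i powr s)"
    using spectral_decompD[OF A] by (intro spectral_decompI) (auto simp: X_def)
  then have "powr_witness X" using A d_pos unfolding powr_witness_def by blast
  ultimately have "powr_witness (mat_powr A s)" using someI[of powr_witness] by simp
  then obtain V e where V: "spectral_decomp n A V e"
    "spectral_decomp n (mat_powr A s) V (\<lambda>i. e i powr s)"
    unfolding powr_witness_def by blast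
  then have "mat_powr A s = X"
    using functional_calculus_unique[OF V(1) A V(2), of X] X by simp
  then show ?thesis using X by simp
qed

lemma posdef_spectral_decomp_powr:
  assumes "posdef n A"
  obtains U d where "spectral_decomp n A U d" "\<And>i. i < n \<Longrightarrow> d i > 0"
    "\<And>s. spectral_decomp n (mat_powr A s) U (\<lambda>i. d i powr s)"
  using posdef_spectral_decomp_eigs[OF assms] spectral_decomp_mat_powr by metis

lemma posdef_mat_powr:
  assumes "posdef n A"
  shows "posdef n (mat_powr A s)"
proof -
  obtain U d where d_pos: "\<And>i. i < n \<Longrightarrow> d i > 0"
    and powr: "\<And>s. spectral_decomp n (mat_powr A s) U (\<lambda>i. d i powr s)"
    using posdef_spectral_decomp_powr[OF assms] by metis
  show ?thesis using d_pos by (intro spectral_decomp_posdef[OF powr]) force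
qed

lemma mat_powr_carrier: "posdef n A \<Longrightarrow> mat_powr A s \<in> carrier_mat n n"
  using posdef_mat_powr posdefD(1) by blast

lemma mat_powr_add:
  assumes "posdef n A"
  shows "mat_powr A a * mat_powr A b = mat_powr A (a + b)"
proof -
  obtain U d where powr: "\<And>s. spectral_decomp n (mat_powr A s) U (\<lambda>i. d i powr s)"
    using posdef_spectral_decomp_powr[OF assms] by metis
  show ?thesis
    by (rule spectral_decomp_unique[OF spectral_decomp_mult[OF powr powr] powr]) (simp add: powr_add)
qed

lemma mat_powr_zero:
  assumes "posdef n A"
  shows "mat_powr A 0 = 1\<^sub>m n"
proof -
  obtain U d where A: "spectral_decomp n A U d" and d_pos: "\<And>i. i < n \<Longrightarrow> d i > 0"
    and powr: "\<And>s. spectral_decomp n (mat_powr A s) U (\<lambda>i. d i powr s)"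
    using posdef_spectral_decomp_powr[OF assms] by metis
  show ?thesis
    by (rule spectral_decomp_unique[OF powr spectral_decomp_one[OF A]]) (use d_pos in force)
qed

lemma mat_powr_one:
  assumes "posdef n A"
  shows "mat_powr A 1 = A"
proof -
  obtain U d where A: "spectral_decomp n A U d" and d_pos: "\<And>i. i < n \<Longrightarrow> d i > 0"
    and powr: "\<And>s. spectral_decomp n (mat_powr A s) U (\<lambda>i. d i powr s)"
    using posdef_spectral_decomp_powr[OF assms] by metis
  show ?thesis
    by (rule spectral_decomp_unique[OF powr A]) (use d_pos in \<open>simp add: less_imp_le\<close>)
qed

lemma mat_powr_mat_powr:
  assumes "posdef n A"
  shows "mat_powr (mat_powr A a) b = mat_powr A (a * b)"
proof -
  obtain U d where d_pos: "\<And>i. i < n \<Longrightarrow> d i > 0"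
    and powr: "\<And>s. spectral_decomp n (mat_powr A s) U (\<lambda>i. d i powr s)"
    using posdef_spectral_decomp_powr[OF assms] by metis
  have "spectral_decomp n (mat_powr (mat_powr A a) b) U (\<lambda>i. (d i powr a) powr b)"
    using d_pos by (intro spectral_decomp_mat_powr[OF powr]) force
  then show ?thesis by (rule spectral_decomp_unique[OF _ powr]) (simp add: powr_powr)
qed

lemma posdef_smult:
  assumes "posdef n A" "c > 0"
  shows "posdef n (complex_of_real c \<cdot>\<^sub>m A)"
proof -
  obtain U d where A: "spectral_decomp n A U d" and d_pos: "\<And>i. i < n \<Longrightarrow> d i > 0"
    using posdef_spectral_decomp_powr[OF assms(1)] by metis
  show ?thesis
    using d_pos assms(2) by (intro spectral_decomp_posdef[OF spectral_decomp_smult[OF A]]) simp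
qed

lemma mat_powr_smult:
  assumes "posdef n A" "c > 0"
  shows "mat_powr (complex_of_real c \<cdot>\<^sub>m A) s = complex_of_real (c powr s) \<cdot>\<^sub>m mat_powr A s"
proof -
  obtain U d where A: "spectral_decomp n A U d" and d_pos: "\<And>i. i < n \<Longrightarrow> d i > 0"
    and powr: "\<And>s. spectral_decomp n (mat_powr A s) U (\<lambda>i. d i powr s)"
    using posdef_spectral_decomp_powr[OF assms(1)] by metis
  have "spectral_decomp n (mat_powr (complex_of_real c \<cdot>\<^sub>m A) s) U (\<lambda>i. (c * d i) powr s)"
    using d_pos assms(2) by (intro spectral_decomp_mat_powr[OF spectral_decomp_smult[OF A]]) simp
  then show ?thesis
    by (rule spectral_decomp_unique[OF _ spectral_decomp_smult[OF powr]])
      (use d_pos assms(2) in \<open>simp add: powr_mult less_imp_le\<close>)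
qed

lemma posdef_det:
  assumes "posdef n A"
  shows "det A = complex_of_real (Re (det A))" "Re (det A) > 0"
    "det (mat_powr A s) = complex_of_real (Re (det A) powr s)"
proof -
  obtain U d where A: "spectral_decomp n A U d" and d_pos: "\<And>i. i < n \<Longrightarrow> d i > 0"
    and powr: "\<And>s. spectral_decomp n (mat_powr A s) U (\<lambda>i. d i powr s)"
    using posdef_spectral_decomp_powr[OF assms] by metis
  show "det A = complex_of_real (Re (det A))" by (simp add: spectral_decomp_det[OF A])
  show "Re (det A) > 0"
    using d_pos by (auto simp: spectral_decomp_det[OF A] simp del: of_real_prod intro: prod_pos)
  show "det (mat_powr A s) = complex_of_real (Re (det A) powr s)"
    using d_pos
    by (simp add: spectral_decomp_det[OF A] spectral_decomp_det[OF powr] prod_powr_distrib less_imp_le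
        del: of_real_prod)
qed

lemma mat_inv_unique:
  assumes "A \<in> carrier_mat n n" "X \<in> carrier_mat n n" "A * X = 1\<^sub>m n" "X * A = 1\<^sub>m n"
  shows "mat_inv A = X"
  unfolding mat_inv_def
proof (rule some_equality)
  fix Y
  assume "Y \<in> carrier_mat (dim_row A) (dim_row A) \<and> A * Y = 1\<^sub>m (dim_row A) \<and> Y * A = 1\<^sub>m (dim_row A)"
  then have Y: "Y \<in> carrier_mat n n" "A * Y = 1\<^sub>m n" using assms(1) by auto
  have "Y = (X * A) * Y" using assms(4) Y(1) by simp
  also have "\<dots> = X * (A * Y)" using assms(1,2) Y(1) by (intro square_mult_assoc)
  finally show "Y = X" using assms(2) by (simp add: Y(2))
qed (use assms in auto)

lemma mat_inv_eq_mat_powr: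
  assumes "posdef n A"
  shows "mat_inv A = mat_powr A (- 1)"
proof (rule mat_inv_unique)
  show "A \<in> carrier_mat n n" "mat_powr A (- 1) \<in> carrier_mat n n"
    using posdefD(1)[OF assms] mat_powr_carrier[OF assms] by auto
  show "A * mat_powr A (- 1) = 1\<^sub>m n" "mat_powr A (- 1) * A = 1\<^sub>m n"
    using mat_powr_add[OF assms, of 1 "- 1"] mat_powr_add[OF assms, of "- 1" 1]
    by (simp_all add: mat_powr_one[OF assms] mat_powr_zero[OF assms])
qed

abbreviation powr_sandwich :: "complex mat \<Rightarrow> real \<Rightarrow> complex mat \<Rightarrow> complex mat" where
  "powr_sandwich A s X \<equiv> mat_powr A s * X * mat_powr A s"

lemma powr_sandwich_mat_powr:
  assumes "posdef n A"
  shows "powr_sandwich A a (mat_powr A b) = mat_powr A (2 * a + b)"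
  using assms by (simp add: mat_powr_add algebra_simps)

lemma powr_sandwich_one:
  assumes "posdef n A"
  shows "powr_sandwich A a (1\<^sub>m n) = mat_powr A (2 * a)"
  using powr_sandwich_mat_powr[OF assms, of a 0] mat_powr_zero[OF assms] by simp

lemma powr_sandwich_powr_sandwich:
  assumes A: "posdef n A" and X: "X \<in> carrier_mat n n"
  shows "powr_sandwich A a (powr_sandwich A b X) = powr_sandwich A (a + b) X"
proof -
  have "powr_sandwich A a (powr_sandwich A b X) =
      (mat_powr A a * mat_powr A b) * X * (mat_powr A b * mat_powr A a)"
    using mat_powr_carrier[OF A] X by (simp add: square_mult[where n = n])
  then show ?thesis using A by (simp add: mat_powr_add add.commute)
qed

lemma powr_sandwich_cancel:
  assumes "posdef n A" "X \<in> carrier_mat n n" "a + b = 0"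
  shows "powr_sandwich A a (powr_sandwich A b X) = X"
  using assms by (simp add: powr_sandwich_powr_sandwich mat_powr_zero)

lemma posdef_powr_sandwich: "posdef n A \<Longrightarrow> posdef n X \<Longrightarrow> posdef n (powr_sandwich A s X)"
  by (intro posdef_congruence posdef_mat_powr)

section \<open>The Loewner-Heinz inequality\<close>

definition loewner_le :: "nat \<Rightarrow> complex mat \<Rightarrow> complex mat \<Rightarrow> bool" where
  "loewner_le n A B \<longleftrightarrow> (\<forall>v \<in> carrier_vec n. quad_form A v \<le> quad_form B v)"

lemma loewner_leD: "loewner_le n A B \<Longrightarrow> v \<in> carrier_vec n \<Longrightarrow> quad_form A v \<le> quad_form B v"
  by (simp add: loewner_le_def)

lemma loewner_le_trans: "loewner_le n A B \<Longrightarrow> loewner_le n B C \<Longrightarrow> loewner_le n A C"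
  unfolding loewner_le_def by (meson order_trans)

lemma loewner_le_smult:
  assumes "loewner_le n A (complex_of_real c \<cdot>\<^sub>m B)" "A \<in> carrier_mat n n" "B \<in> carrier_mat n n" "r \<ge> 0"
  shows "loewner_le n (complex_of_real r \<cdot>\<^sub>m A) (complex_of_real (r * c) \<cdot>\<^sub>m B)"
  unfolding loewner_le_def
proof
  fix v :: "complex vec" assume v: "v \<in> carrier_vec n"
  show "quad_form (complex_of_real r \<cdot>\<^sub>m A) v \<le> quad_form (complex_of_real (r * c) \<cdot>\<^sub>m B) v"
    using loewner_leD[OF assms(1) v] assms(4)
    by (simp add: quad_form_smult[OF assms(2) v] quad_form_smult[OF assms(3) v] mult.assoc
        mult_left_mono del: of_real_mult)
qed

lemma loewner_le_congruence:
  assumes "loewner_le n A B" "A \<in> carrier_mat n n" "B \<in> carrier_mat n n" "posdef n H"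
  shows "loewner_le n (H * A * H) (H * B * H)"
proof -
  note H = posdefD[OF assms(4)]
  show ?thesis
    using assms(1) H(1) quad_form_congruence[OF assms(2) H(1)] quad_form_congruence[OF assms(3) H(1)]
    by (simp add: loewner_le_def H(3))
qed

lemma sandwich_smult:
  assumes "H \<in> carrier_mat n n" "X \<in> carrier_mat n n"
  shows "H * (c \<cdot>\<^sub>m X) * H = c \<cdot>\<^sub>m (H * X * H :: 'a :: comm_semiring_0 mat)"
  using assms
  by (simp add: mult_smult_distrib[of _ n n _ n] mult_smult_assoc_mat[of _ n n _ n]
      square_mult_carrier[where n = n])

lemma loewner_le_smult_congruence:
  assumes "loewner_le n A (complex_of_real c \<cdot>\<^sub>m B)" "A \<in> carrier_mat n n" "B \<in> carrier_mat n n"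
    "posdef n H"
  shows "loewner_le n (H * A * H) (complex_of_real c \<cdot>\<^sub>m (H * B * H))"
  using loewner_le_congruence[OF assms(1,2) _ assms(4)] assms(3)
  by (simp add: sandwich_smult[OF posdefD(1)[OF assms(4)] assms(3)])

lemma loewner_le_smult_one_iff:
  assumes A: "spectral_decomp n A U d"
  shows "loewner_le n A (complex_of_real c \<cdot>\<^sub>m 1\<^sub>m n) \<longleftrightarrow> (\<forall>i<n. d i \<le> c)"
proof
  assume A_le: "loewner_le n A (complex_of_real c \<cdot>\<^sub>m 1\<^sub>m n)"
  show "\<forall>i<n. d i \<le> c"
  proof (intro allI impI)
    fix i assume i: "i < n"
    note col = spectral_decomp_col(1)[OF A i]
    show "d i \<le> c"
      using loewner_leD[OF A_le col] spectral_decomp_quad_form_col[OF A i]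
        spectral_decomp_quad_form_col[OF spectral_decomp_one[OF A] i]
      by (simp add: quad_form_smult[OF one_carrier_mat col])
  qed
next
  assume d_le: "\<forall>i<n. d i \<le> c"
  show "loewner_le n A (complex_of_real c \<cdot>\<^sub>m 1\<^sub>m n)"
    unfolding loewner_le_def
  proof
    fix v :: "complex vec" assume v: "v \<in> carrier_vec n"
    show "quad_form A v \<le> quad_form (complex_of_real c \<cdot>\<^sub>m 1\<^sub>m n) v"
      unfolding quad_form_smult[OF one_carrier_mat v] quad_form_spectral[OF A v]
        quad_form_spectral[OF spectral_decomp_one[OF A] v] sum_distrib_left
      using d_le by (intro sum_mono) (auto intro: mult_right_mono simp del: index_mult_mat_vec)
  qed
qed

lemma Re_cscalar_prod_le:
  fixes x y :: "complex vec"
  assumes "x \<in> carrier_vec n" "y \<in> carrier_vec n"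
  shows "2 * Re (x \<bullet>c y) \<le> Re (x \<bullet>c x) + Re (y \<bullet>c y)"
proof -
  have "2 * Re (a * cnj b) \<le> Re (a * cnj a) + Re (b * cnj b)" for a b :: complex
    using sum_squares_bound[of "Re a" "Re b"] sum_squares_bound[of "Im a" "Im b"]
    by (simp add: power2_eq_square)
  then have "(\<Sum>i = 0..<n. 2 * Re (x $ i * cnj (y $ i)))
      \<le> (\<Sum>i = 0..<n. Re (x $ i * cnj (x $ i)) + Re (y $ i * cnj (y $ i)))"
    by (intro sum_mono)
  then show ?thesis using assms by (simp add: scalar_prod_def sum.distrib sum_distrib_left)
qed

definition contraction_mat :: "nat \<Rightarrow> complex mat \<Rightarrow> bool" where
  "contraction_mat n X \<longleftrightarrow> X \<in> carrier_mat n n \<and> loewner_le n (mat_adjoint X * X) (1\<^sub>m n)"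

lemma contraction_matD:
  assumes "contraction_mat n X" "v \<in> carrier_vec n"
  shows "X \<in> carrier_mat n n" "Re ((X *\<^sub>v v) \<bullet>c (X *\<^sub>v v)) \<le> Re (v \<bullet>c v)"
proof -
  show X: "X \<in> carrier_mat n n" using assms(1) by (simp add: contraction_mat_def)
  show "Re ((X *\<^sub>v v) \<bullet>c (X *\<^sub>v v)) \<le> Re (v \<bullet>c v)"
    using assms quad_form_congruence[OF one_carrier_mat X assms(2)] X
    by (auto simp: contraction_mat_def loewner_le_def quad_form_def)
qed

lemma contraction_product_eigenvalue_le_one:
  assumes X: "contraction_mat n X" and Y: "contraction_mat n Y"
    and v: "v \<in> carrier_vec n" "v \<noteq> 0\<^sub>v n"
    and eigen: "(mat_adjoint X * Y) *\<^sub>v v = complex_of_real c \<cdot>\<^sub>v v"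
  shows "c \<le> 1"
proof -
  note X' = contraction_matD[OF X v(1)] and Y' = contraction_matD[OF Y v(1)]
  have "c * Re (v \<bullet>c v) = Re ((complex_of_real c \<cdot>\<^sub>v v) \<bullet>c v)" using v(1) by simp
  also have "\<dots> = Re ((mat_adjoint X *\<^sub>v (Y *\<^sub>v v)) \<bullet>c v)"
    unfolding eigen[symmetric] using X'(1) Y'(1) v(1) by (simp add: assoc_mult_mat_vec[of _ n n _ n])
  also have "\<dots> = Re ((Y *\<^sub>v v) \<bullet>c (X *\<^sub>v v))"
    using cscalar_prod_mat_adjoint[of "mat_adjoint X" n n "Y *\<^sub>v v" v] X'(1) Y'(1) v(1) by simp
  also have "\<dots> \<le> 1 * Re (v \<bullet>c v)"
    using Re_cscalar_prod_le[of "Y *\<^sub>v v" n "X *\<^sub>v v"] X' Y' v(1) by simp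
  finally show ?thesis
    using conjugate_square_greater_0_vec[OF v(1)] v(2) by (simp add: less_complex_def)
qed

lemma contraction_mat_powr_quotient:
  assumes A: "posdef n A" and B: "posdef n B" and powr_le: "loewner_le n (mat_powr A r) (mat_powr B r)"
  shows "contraction_mat n (mat_powr A (r / 2) * mat_powr B (- r / 2))"
proof -
  define X where "X = mat_powr A (r / 2) * mat_powr B (- r / 2)"
  note A' = posdefD[OF posdef_mat_powr[OF A]] and B' = posdefD[OF posdef_mat_powr[OF B]]
  have "mat_adjoint X * X = powr_sandwich B (- r / 2) (mat_powr A (r / 2) * mat_powr A (r / 2))"
    unfolding X_def using A'(1) B'(1)
    by (simp add: mat_adjoint_mult[of _ n n _ n] A'(3) B'(3) square_mult[where n = n])
  also have "mat_powr A (r / 2) * mat_powr A (r / 2) = mat_powr A r"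
    by (simp add: mat_powr_add[OF A])
  finally have "mat_adjoint X * X = powr_sandwich B (- r / 2) (mat_powr A r)" .
  moreover have "powr_sandwich B (- r / 2) (mat_powr B r) = 1\<^sub>m n"
    using powr_sandwich_mat_powr[OF B, of "- r / 2" r] by (simp add: mat_powr_zero[OF B])
  ultimately show ?thesis
    using loewner_le_congruence[OF powr_le A'(1) B'(1) posdef_mat_powr[OF B, of "- r / 2"]] A'(1) B'(1)
    unfolding X_def[symmetric] by (simp add: contraction_mat_def X_def square_mult_carrier)
qed

lemma loewner_le_one_if_similar_contraction_product:
  assumes X: "contraction_mat n X" and Y: "contraction_mat n Y" and H: "posdef n H" and M: "posdef n M"
    and similar: "mat_adjoint X * Y * H = H * M"
  shows "loewner_le n M (1\<^sub>m n)"
proof -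
  obtain U d where U: "spectral_decomp n M U d" using posdef_spectral_decomp_powr[OF M] by metis
  have carrier: "mat_adjoint X * Y \<in> carrier_mat n n"
    using X Y by (simp add: contraction_mat_def square_mult_carrier)
  have "d i \<le> 1" if i: "i < n" for i
  proof (rule contraction_product_eigenvalue_le_one[OF X Y])
    note u = spectral_decomp_col[OF U i]
    show "H *\<^sub>v col U i \<in> carrier_vec n" using posdefD(1)[OF H] u(1) by simp
    show "H *\<^sub>v col U i \<noteq> 0\<^sub>v n" using u(1,2) by (intro posdef_mult_vec_nonzero[OF H]) auto
    have "(mat_adjoint X * Y) *\<^sub>v (H *\<^sub>v col U i) = H *\<^sub>v (M *\<^sub>v col U i)"
      using assoc_mult_mat_vec[OF carrier posdefD(1)[OF H] u(1)]
        assoc_mult_mat_vec[OF posdefD(1)[OF H] posdefD(1)[OF M] u(1)] similar by simp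
    also have "\<dots> = complex_of_real (d i) \<cdot>\<^sub>v (H *\<^sub>v col U i)"
      using posdefD(1)[OF H] u(1) by (simp add: u(3) mult_mat_vec)
    finally show "(mat_adjoint X * Y) *\<^sub>v (H *\<^sub>v col U i) = complex_of_real (d i) \<cdot>\<^sub>v (H *\<^sub>v col U i)" .
  qed
  moreover have "complex_of_real 1 \<cdot>\<^sub>m 1\<^sub>m n = 1\<^sub>m n" by (rule eq_matI) auto
  ultimately show ?thesis using loewner_le_smult_one_iff[OF U, of 1] by metis
qed

lemma powr_quotient_product_similar:
  fixes a b :: real
  assumes A: "posdef n A" and B: "posdef n B"
  defines "X \<equiv> mat_powr A (b / 2) * mat_powr B (- b / 2)"
    and "Y \<equiv> mat_powr A (a / 2) * mat_powr B (- a / 2)"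
    and "H \<equiv> mat_powr B ((a - b) / 4)"
  shows "mat_adjoint X * Y * H = H * powr_sandwich B (- ((a + b) / 4)) (mat_powr A ((a + b) / 2))"
proof -
  note A' = posdefD[OF posdef_mat_powr[OF A]] and B' = posdefD[OF posdef_mat_powr[OF B]]
  have exponents: "b / 2 + a / 2 = (a + b) / 2" "- a / 2 + (a - b) / 4 = - ((a + b) / 4)"
    "(a - b) / 4 + - ((a + b) / 4) = - b / 2"
    by (simp_all add: field_simps)
  have "mat_adjoint X * Y * H =
      mat_powr B (- b / 2) * (mat_powr A (b / 2) * mat_powr A (a / 2)) * (mat_powr B (- a / 2) * H)"
    unfolding X_def Y_def H_def using A'(1) B'(1)
    by (simp add: mat_adjoint_mult[of _ n n _ n] A'(3) B'(3) square_mult[where n = n])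
  also have "\<dots> = mat_powr B (- b / 2) * mat_powr A ((a + b) / 2) * mat_powr B (- ((a + b) / 4))"
    unfolding H_def by (simp only: mat_powr_add[OF A] mat_powr_add[OF B] exponents)
  also have "mat_powr B (- b / 2) = H * mat_powr B (- ((a + b) / 4))"
    unfolding H_def by (simp only: mat_powr_add[OF B] exponents)
  finally show ?thesis
    unfolding H_def using A'(1) B'(1) by (simp add: square_mult[where n = n])
qed

text \<open>Pedersen's argument: \<open>B\<^sup>-\<^sup>q A\<^sup>2\<^sup>q B\<^sup>-\<^sup>q\<close> with \<open>q = (a + b) / 4\<close> is similar, through a power of
  \<open>B\<close>, to the product of the contraction \<open>A\<^bsup>a/2\<^esup> B\<^bsup>-a/2\<^esup>\<close> and the adjoint of the contraction
  \<open>A\<^bsup>b/2\<^esup> B\<^bsup>-b/2\<^esup>\<close>.\<close>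

lemma loewner_heinz_midpoint:
  assumes A: "posdef n A" and B: "posdef n B"
    and le_a: "loewner_le n (mat_powr A a) (mat_powr B a)"
    and le_b: "loewner_le n (mat_powr A b) (mat_powr B b)"
  shows "loewner_le n (mat_powr A ((a + b) / 2)) (mat_powr B ((a + b) / 2))"
proof -
  let ?q = "(a + b) / 4"
  define M where "M = powr_sandwich B (- ?q) (mat_powr A ((a + b) / 2))"
  have M: "posdef n M" unfolding M_def by (intro posdef_powr_sandwich posdef_mat_powr A B)
  have "loewner_le n M (1\<^sub>m n)"
    using powr_quotient_product_similar[OF A B, of b a, folded M_def]
    by (rule loewner_le_one_if_similar_contraction_product[OF contraction_mat_powr_quotient[OF A B le_b]
          contraction_mat_powr_quotient[OF A B le_a] posdef_mat_powr[OF B] M])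
  from loewner_le_congruence[OF this posdefD(1)[OF M] one_carrier_mat posdef_mat_powr[OF B, of ?q]]
  have "loewner_le n (mat_powr A ((a + b) / 2)) (mat_powr B (2 * ?q))"
    unfolding M_def
    by (simp only: powr_sandwich_cancel[OF B mat_powr_carrier[OF A]] powr_sandwich_one[OF B]
        add.right_inverse)
  moreover have "2 * ?q = (a + b) / 2" by (simp add: field_simps)
  ultimately show ?thesis by (simp only:)
qed

lemma continuous_quad_form_mat_powr:
  assumes "posdef n A" "v \<in> carrier_vec n"
  shows "continuous_on UNIV (\<lambda>s. quad_form (mat_powr A s) v)"
proof -
  obtain U d where d_pos: "\<And>i. i < n \<Longrightarrow> d i > 0"
    and powr: "\<And>s. spectral_decomp n (mat_powr A s) U (\<lambda>i. d i powr s)"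
    using posdef_spectral_decomp_powr[OF assms(1)] by metis
  have "d i \<noteq> 0" if "i < n" for i using d_pos[OF that] by simp
  then show ?thesis
    by (auto simp: quad_form_spectral[OF powr assms(2)] simp del: index_mult_mat_vec
        intro!: continuous_intros)
qed

lemma closed_midpoint_convex_Icc:
  fixes T :: "real set"
  assumes closed: "closed T" and midpoint: "\<And>a b. a \<in> T \<Longrightarrow> b \<in> T \<Longrightarrow> (a + b) / 2 \<in> T"
    and T: "l \<in> T" "u \<in> T"
  shows "{l..u} \<subseteq> T"
proof
  fix s assume s: "s \<in> {l..u}"
  have "compact (T \<inter> {l..s})" "compact (T \<inter> {s..u})"
    using compact_Int_closed[OF compact_Icc closed] by (simp_all add: Int_commute)
  moreover have "T \<inter> {l..s} \<noteq> {}" "T \<inter> {s..u} \<noteq> {}" using T s by auto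
  ultimately obtain a b where a: "a \<in> T \<inter> {l..s}" "\<forall>x \<in> T \<inter> {l..s}. x \<le> a"
    and b: "b \<in> T \<inter> {s..u}" "\<forall>x \<in> T \<inter> {s..u}. b \<le> x"
    using compact_attains_sup compact_attains_inf by metis
  have "a = b"
  proof (rule ccontr)
    assume "a \<noteq> b"
    then have "a < (a + b) / 2" "(a + b) / 2 < b" using a(1) b(1) by auto
    moreover have "(a + b) / 2 \<in> T" using midpoint a(1) b(1) by auto
    ultimately show False using a b by (cases "(a + b) / 2 \<le> s") force+
  qed
  then show "s \<in> T" using a(1) b(1) by auto
qed

theorem loewner_heinz:
  assumes A: "posdef n A" and B: "posdef n B" and A_le_B: "loewner_le n A B" and s: "0 \<le> s" "s \<le> 1"
  shows "loewner_le n (mat_powr A s) (mat_powr B s)"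
proof -
  define T where "T = {s. loewner_le n (mat_powr A s) (mat_powr B s)}"
  have "T = (\<Inter>v \<in> carrier_vec n. {s. quad_form (mat_powr A s) v \<le> quad_form (mat_powr B s) v})"
    by (auto simp: T_def loewner_le_def)
  also have "closed \<dots>"
    by (intro closed_INT ballI closed_Collect_le)
      (auto intro: continuous_quad_form_mat_powr[OF A] continuous_quad_form_mat_powr[OF B])
  finally have "closed T" .
  moreover have "(a + b) / 2 \<in> T" if "a \<in> T" "b \<in> T" for a b
    using that loewner_heinz_midpoint[OF A B] by (simp add: T_def)
  moreover have "0 \<in> T" by (simp add: T_def loewner_le_def mat_powr_zero[OF A] mat_powr_zero[OF B])
  moreover have "1 \<in> T" using A_le_B by (simp add: T_def mat_powr_one[OF A] mat_powr_one[OF B])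
  ultimately have "{0..1} \<subseteq> T" by (rule closed_midpoint_convex_Icc)
  then show ?thesis using s by (auto simp: T_def)
qed

lemma loewner_heinz_smult:
  assumes "posdef n A" "posdef n B" "loewner_le n A (complex_of_real c \<cdot>\<^sub>m B)" "c > 0" "0 \<le> s" "s \<le> 1"
  shows "loewner_le n (mat_powr A s) (complex_of_real (c powr s) \<cdot>\<^sub>m mat_powr B s)"
  using loewner_heinz[OF assms(1) posdef_smult[OF assms(2,4)] assms(3,5,6)]
  by (simp add: mat_powr_smult[OF assms(2,4)])

section \<open>The Cauchy-Binet formula\<close>

lemma bij_betw_pick:
  assumes "finite S"
  shows "bij_betw (pick S) {0..<card S} S"
proof -
  have "inj_on (pick S) {0..<card S}"
    by (rule linorder_inj_onI) (use pick_mono_le in \<open>force simp: less_le\<close>)+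
  moreover have "pick S ` {0..<card S} \<subseteq> S" using pick_in_set_le by auto
  ultimately show ?thesis
    using assms by (simp add: bij_betw_def card_image card_subset_eq)
qed

lemma le_pick:
  assumes "i < card S"
  shows "i \<le> pick S i"
  using assms by (induction i) (use pick_mono_le in \<open>force simp: Suc_le_eq intro: le_less_trans\<close>)+

lemma submatrix_carrier:
  assumes "A \<in> carrier_mat m n"
  shows "submatrix A I J \<in> carrier_mat (card ({..<m} \<inter> I)) (card ({..<n} \<inter> J))"
  using assms by (auto simp: dim_submatrix Int_def)

lemma submatrix_nth:
  assumes "A \<in> carrier_mat m n" "i < card ({..<m} \<inter> I)" "j < card ({..<n} \<inter> J)"
  shows "submatrix A I J $$ (i, j) = A $$ (pick I i, pick J j)"
  using assms by (intro submatrix_index) (auto simp: Int_def)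

lemma submatrix_UNIV_right_split: "submatrix A I J = submatrix (submatrix A I UNIV) UNIV J"
proof (rule eq_matI)
  fix i j
  assume "i < dim_row (submatrix (submatrix A I UNIV) UNIV J)"
    "j < dim_col (submatrix (submatrix A I UNIV) UNIV J)"
  then have ij: "i < card {i. i < dim_row A \<and> i \<in> I}" "j < card {j. j < dim_col A \<and> j \<in> J}"
    by (simp_all add: dim_submatrix)
  then show "submatrix A I J $$ (i, j) = submatrix (submatrix A I UNIV) UNIV J $$ (i, j)"
    using pick_le[OF ij(2)] by (simp add: submatrix_index dim_submatrix pick_UNIV)
qed (simp_all add: dim_submatrix)

lemma submatrix_mult:
  assumes "A \<in> carrier_mat m n" "B \<in> carrier_mat n p"
  shows "submatrix (A * B) I J = submatrix A I UNIV * submatrix B UNIV J"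
proof (rule eq_matI)
  fix i j
  assume "i < dim_row (submatrix A I UNIV * submatrix B UNIV J)"
    "j < dim_col (submatrix A I UNIV * submatrix B UNIV J)"
  then have ij: "i < card {i. i < m \<and> i \<in> I}" "j < card {j. j < p \<and> j \<in> J}"
    using assms by (simp_all add: dim_submatrix)
  then show "submatrix (A * B) I J $$ (i, j) = (submatrix A I UNIV * submatrix B UNIV J) $$ (i, j)"
    using assms pick_le[OF ij(1)] pick_le[OF ij(2)]
    by (simp add: submatrix_index dim_submatrix pick_UNIV scalar_prod_def)
qed (use assms in \<open>simp_all add: dim_submatrix\<close>)

lemma submatrix_mat_adjoint:
  assumes "A \<in> carrier_mat m n"
  shows "submatrix (mat_adjoint A) J I = mat_adjoint (submatrix A I J)"
proof (rule eq_matI)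
  fix j i
  assume "j < dim_row (mat_adjoint (submatrix A I J))" "i < dim_col (mat_adjoint (submatrix A I J))"
  then have ij: "i < card {i. i < m \<and> i \<in> I}" "j < card {j. j < n \<and> j \<in> J}"
    using assms by (simp_all add: dim_submatrix)
  then show "submatrix (mat_adjoint A) J I $$ (j, i) = mat_adjoint (submatrix A I J) $$ (j, i)"
    using assms pick_le[OF ij(1)] pick_le[OF ij(2)] by (simp add: submatrix_index dim_submatrix)
qed (use assms in \<open>simp_all add: dim_submatrix\<close>)

lemma bij_betw_permutes_bijections:
  assumes e: "bij_betw e K S"
  shows "bij_betw (\<lambda>p i. if i \<in> K then e (p i) else i) {p. p permutes K}
    {g. bij_betw g K S \<and> (\<forall>i. i \<notin> K \<longrightarrow> g i = i)}"
    (is "bij_betw ?\<Phi> ?P ?G")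
proof (rule bij_betw_byWitness[where f' = "\<lambda>g i. if i \<in> K then inv_into K e (g i) else i"])
  note inv = bij_betw_inv_into[OF e]
  show "\<forall>p\<in>?P. (\<lambda>i. if i \<in> K then inv_into K e (?\<Phi> p i) else i) = p"
    using bij_betw_inv_into_left[OF e] by (auto simp: fun_eq_iff permutes_in_image permutes_not_in)
  show "\<forall>g\<in>?G. ?\<Phi> (\<lambda>i. if i \<in> K then inv_into K e (g i) else i) = g"
    using bij_betw_inv_into_right[OF e] by (auto simp: fun_eq_iff dest: bij_betwE)
  have "bij_betw (?\<Phi> p) K S" if "p permutes K" for p
    using bij_betw_trans[OF permutes_imp_bij[OF that] e]
    by (rule bij_betw_cong[THEN iffD1, rotated]) auto
  then show "?\<Phi> ` ?P \<subseteq> ?G" by auto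
  have "(\<lambda>i. if i \<in> K then inv_into K e (g i) else i) permutes K" if "bij_betw g K S" for g
  proof (rule bij_imp_permutes)
    show "bij_betw (\<lambda>i. if i \<in> K then inv_into K e (g i) else i) K K"
      using bij_betw_trans[OF that inv] by (rule bij_betw_cong[THEN iffD1, rotated]) auto
  qed auto
  then show "(\<lambda>g i. if i \<in> K then inv_into K e (g i) else i) ` ?G \<subseteq> ?P" by auto
qed

definition row_choices :: "nat \<Rightarrow> nat \<Rightarrow> (nat \<Rightarrow> nat) set" where
  "row_choices k n = {g. (\<forall>i\<in>{0..<k}. g i \<in> {0..<n}) \<and> (\<forall>i. i \<notin> {0..<k} \<longrightarrow> g i = i)}"

lemma finite_row_choices: "finite (row_choices k n)"
  unfolding row_choices_def by (rule finite_bounded_functions) auto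

lemma det_mult_expand_rows:
  fixes A B :: "'a :: comm_ring_1 mat"
  assumes A: "A \<in> carrier_mat k n" and B: "B \<in> carrier_mat n k"
  shows "det (A * B) = (\<Sum>g\<in>row_choices k n.
    (\<Prod>i = 0..<k. A $$ (i, g i)) * det (mat\<^sub>r k k (\<lambda>i. row B (g i))))"
proof -
  have "det (A * B) = (\<Sum>g\<in>row_choices k n. det (mat\<^sub>r k k (\<lambda>i. A $$ (i, g i) \<cdot>\<^sub>v row B (g i))))"
    unfolding mat_mul_finsum_alt[OF A B] row_choices_def using B by (intro det_linear_rows_sum) auto
  also have "\<dots> = (\<Sum>g\<in>row_choices k n. (\<Prod>i = 0..<k. A $$ (i, g i)) * det (mat\<^sub>r k k (\<lambda>i. row B (g i))))"
    using B by (intro sum.cong det_rows_mul) auto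
  finally show ?thesis .
qed

lemma sum_row_choices_onto:
  fixes A B :: "'a :: comm_ring_1 mat"
  assumes A: "A \<in> carrier_mat k n" and B: "B \<in> carrier_mat n k" and S: "S \<subseteq> {..<n}" "card S = k"
  shows "(\<Sum>g | bij_betw g {0..<k} S \<and> (\<forall>i. i \<notin> {0..<k} \<longrightarrow> g i = i).
      (\<Prod>i = 0..<k. A $$ (i, g i)) * det (mat\<^sub>r k k (\<lambda>i. row B (g i)))) =
    det (submatrix A UNIV S) * det (submatrix B S UNIV)"
proof -
  let ?choice = "\<lambda>p i. if i \<in> {0..<k} then pick S (p i) else i"
  let ?AS = "submatrix A UNIV S" and ?BS = "submatrix B S UNIV"
  have "finite S" using S(1) finite_subset by blast
  then have pick: "bij_betw (pick S) {0..<k} S" using bij_betw_pick S(2) by blast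
  have AS: "?AS \<in> carrier_mat k k" and BS: "?BS \<in> carrier_mat k k"
    using submatrix_carrier[OF A, of UNIV S] submatrix_carrier[OF B, of S UNIV] S
    by (simp_all add: Int_absorb1)
  have nth_AS: "?AS $$ (i, j) = A $$ (i, pick S j)" and nth_BS: "?BS $$ (j, i) = B $$ (pick S j, i)"
    if "i < k" "j < k" for i j
    using submatrix_nth[OF A, of i UNIV j S] submatrix_nth[OF B, of j S i UNIV] S that
    by (simp_all add: Int_absorb1 pick_UNIV)
  have summand: "(\<Prod>i = 0..<k. A $$ (i, ?choice p i)) * det (mat\<^sub>r k k (\<lambda>i. row B (?choice p i))) =
      signof p * (\<Prod>i = 0..<k. ?AS $$ (i, p i)) * det ?BS" if p: "p permutes {0..<k}" for p
  proof -
    have pk: "p i < k" if "i < k" for i using permutes_in_image[OF p, of i] that by simp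
    have "pick S (p i) < n" if "i < k" for i using bij_betwE[OF pick] pk[OF that] S(1) by auto
    then have "mat\<^sub>r k k (\<lambda>i. row B (?choice p i)) = mat k k (\<lambda>(i, j). ?BS $$ (p i, j))"
      using pk B by (intro eq_matI) (auto simp: nth_BS)
    then have "det (mat\<^sub>r k k (\<lambda>i. row B (?choice p i))) = signof p * det ?BS"
      using det_permute_rows[OF BS p] by simp
    then show ?thesis using pk by (simp add: nth_AS)
  qed
  have "(\<Sum>g | bij_betw g {0..<k} S \<and> (\<forall>i. i \<notin> {0..<k} \<longrightarrow> g i = i).
      (\<Prod>i = 0..<k. A $$ (i, g i)) * det (mat\<^sub>r k k (\<lambda>i. row B (g i)))) =
    (\<Sum>p | p permutes {0..<k}. signof p * (\<Prod>i = 0..<k. ?AS $$ (i, p i)) * det ?BS)"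
    by (subst sum.reindex_bij_betw[OF bij_betw_permutes_bijections[OF pick], symmetric])
      (intro sum.cong summand, auto)
  then show ?thesis by (simp add: det_def'[OF AS] sum_distrib_right)
qed

theorem cauchy_binet:
  fixes A B :: "'a :: comm_ring_1 mat"
  assumes A: "A \<in> carrier_mat k n" and B: "B \<in> carrier_mat n k"
  shows "det (A * B) =
    (\<Sum>S | S \<subseteq> {..<n} \<and> card S = k. det (submatrix A UNIV S) * det (submatrix B S UNIV))"
proof -
  let ?term = "\<lambda>g. (\<Prod>i = 0..<k. A $$ (i, g i)) * det (mat\<^sub>r k k (\<lambda>i. row B (g i)))"
  let ?inj = "{g \<in> row_choices k n. inj_on g {0..<k}}"
  have "det (A * B) = sum ?term (row_choices k n)" by (rule det_mult_expand_rows[OF A B])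
  also have "\<dots> = sum ?term ?inj"
  proof (intro sum.mono_neutral_right finite_row_choices ballI)
    fix g assume "g \<in> row_choices k n - ?inj"
    then obtain i j where ij: "i < k" "j < k" "i \<noteq> j" "g i = g j" by (auto simp: inj_on_def)
    have "det (mat\<^sub>r k k (\<lambda>i. row B (g i))) = 0"
      using ij by (intro det_identical_rows[of _ k i j]) auto
    then show "?term g = 0" by simp
  qed auto
  also have "\<dots> = (\<Sum>S | S \<subseteq> {..<n} \<and> card S = k. sum ?term {g \<in> ?inj. g ` {0..<k} = S})"
  proof (rule sum.group[symmetric])
    show "finite ?inj" using finite_row_choices by simp
    show "(\<lambda>g. g ` {0..<k}) ` ?inj \<subseteq> {S. S \<subseteq> {..<n} \<and> card S = k}"
      by (auto simp: row_choices_def card_image)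
  qed simp
  also have "\<dots> = (\<Sum>S | S \<subseteq> {..<n} \<and> card S = k. det (submatrix A UNIV S) * det (submatrix B S UNIV))"
  proof (intro sum.cong refl)
    fix S assume "S \<in> {S. S \<subseteq> {..<n} \<and> card S = k}"
    then have S: "S \<subseteq> {..<n}" "card S = k" by auto
    then have "{g \<in> ?inj. g ` {0..<k} = S} = {g. bij_betw g {0..<k} S \<and> (\<forall>i. i \<notin> {0..<k} \<longrightarrow> g i = i)}"
      by (auto simp: row_choices_def bij_betw_def)
    then show "sum ?term {g \<in> ?inj. g ` {0..<k} = S} = det (submatrix A UNIV S) * det (submatrix B S UNIV)"
      using sum_row_choices_onto[OF A B S] by simp
  qed
  finally show ?thesis .
qed

corollary cauchy_binet_minors:
  fixes A B :: "'a :: comm_ring_1 mat"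
  assumes A: "A \<in> carrier_mat m n" and B: "B \<in> carrier_mat n p"
    and I: "I \<subseteq> {..<m}" "card I = k" and J: "J \<subseteq> {..<p}" "card J = k"
  shows "det (submatrix (A * B) I J) =
    (\<Sum>S | S \<subseteq> {..<n} \<and> card S = k. det (submatrix A I S) * det (submatrix B S J))"
proof -
  have "submatrix A I UNIV \<in> carrier_mat k n" "submatrix B UNIV J \<in> carrier_mat n k"
    using submatrix_carrier[OF A, of I UNIV] submatrix_carrier[OF B, of UNIV J] I J
    by (simp_all add: Int_absorb1)
  from cauchy_binet[OF this] show ?thesis
    by (simp add: submatrix_mult[OF A B] flip: submatrix_UNIV_right_split submatrix_split)
qed

section \<open>Compound matrices\<close>

definition subset_enum :: "nat \<Rightarrow> nat \<Rightarrow> nat \<Rightarrow> nat set" where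
  "subset_enum n k = (SOME e. bij_betw e {..<n choose k} {S. S \<subseteq> {..<n} \<and> card S = k})"

lemma bij_betw_subset_enum:
  "bij_betw (subset_enum n k) {..<n choose k} {S. S \<subseteq> {..<n} \<and> card S = k}"
proof -
  have "finite {S. S \<subseteq> {..<n} \<and> card S = k}" by (rule finite_subset[of _ "Pow {..<n}"]) auto
  from ex_bij_betw_nat_finite[OF this]
  have "\<exists>e. bij_betw e {..<n choose k} {S. S \<subseteq> {..<n} \<and> card S = k}"
    using n_subsets[of "{..<n}" k] by (simp add: atLeast0LessThan)
  then show ?thesis unfolding subset_enum_def by (rule someI_ex)
qed

lemma subset_enum:
  assumes "a < n choose k"
  shows "subset_enum n k a \<subseteq> {..<n}" "card (subset_enum n k a) = k"
  using bij_betwE[OF bij_betw_subset_enum[of n k]] assms by auto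

lemma subset_enum_eq_iff:
  "a < n choose k \<Longrightarrow> b < n choose k \<Longrightarrow> subset_enum n k a = subset_enum n k b \<longleftrightarrow> a = b"
  using inj_on_eq_iff[OF bij_betw_imp_inj_on[OF bij_betw_subset_enum[of n k]]] by simp

definition compound :: "nat \<Rightarrow> 'a :: comm_ring_1 mat \<Rightarrow> 'a mat" where
  "compound k A = mat (dim_row A choose k) (dim_col A choose k)
     (\<lambda>(a, b). det (submatrix A (subset_enum (dim_row A) k a) (subset_enum (dim_col A) k b)))"

lemma compound_carrier [simp]:
  "A \<in> carrier_mat m n \<Longrightarrow> compound k A \<in> carrier_mat (m choose k) (n choose k)"
  by (auto simp: compound_def)

lemma compound_mult:
  fixes A B :: "'a :: comm_ring_1 mat"
  assumes A: "A \<in> carrier_mat m n" and B: "B \<in> carrier_mat n p"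
  shows "compound k (A * B) = compound k A * compound k B"
proof (rule eq_matI)
  fix a b assume "a < dim_row (compound k A * compound k B)" "b < dim_col (compound k A * compound k B)"
  then have ab: "a < m choose k" "b < p choose k" using A B by (auto simp: compound_def)
  let ?I = "subset_enum m k a" and ?J = "subset_enum p k b"
  have "compound k (A * B) $$ (a, b) = det (submatrix (A * B) ?I ?J)"
    using ab A B by (simp add: compound_def)
  also have "\<dots> = (\<Sum>S | S \<subseteq> {..<n} \<and> card S = k. det (submatrix A ?I S) * det (submatrix B S ?J))"
    by (rule cauchy_binet_minors[OF A B subset_enum[OF ab(1)] subset_enum[OF ab(2)]])
  also have "\<dots> = (\<Sum>c<n choose k.
      det (submatrix A ?I (subset_enum n k c)) * det (submatrix B (subset_enum n k c) ?J))"
    by (rule sum.reindex_bij_betw[OF bij_betw_subset_enum, symmetric])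
  also have "\<dots> = (compound k A * compound k B) $$ (a, b)"
    using ab A B by (simp add: compound_def scalar_prod_def atLeast0LessThan)
  finally show "compound k (A * B) $$ (a, b) = (compound k A * compound k B) $$ (a, b)" .
qed (use A B in \<open>simp_all add: compound_def\<close>)

lemma compound_mat_adjoint:
  fixes A :: "complex mat"
  shows "compound k (mat_adjoint A) = mat_adjoint (compound k A)"
proof (rule eq_matI)
  fix b a assume "b < dim_row (mat_adjoint (compound k A))" "a < dim_col (mat_adjoint (compound k A))"
  then have ab: "a < dim_row A choose k" "b < dim_col A choose k" by (auto simp: compound_def)
  let ?I = "subset_enum (dim_row A) k a" and ?J = "subset_enum (dim_col A) k b"
  have A: "A \<in> carrier_mat (dim_row A) (dim_col A)" by simp
  have "submatrix A ?I ?J \<in> carrier_mat k k"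
    using submatrix_carrier[OF A, of ?I ?J] subset_enum[OF ab(1)] subset_enum[OF ab(2)]
    by (simp add: Int_absorb1)
  then show "compound k (mat_adjoint A) $$ (b, a) = mat_adjoint (compound k A) $$ (b, a)"
    using ab by (simp add: compound_def submatrix_mat_adjoint[OF A] det_mat_adjoint)
qed (simp_all add: compound_def)

lemma det_zero_row:
  fixes A :: "'a :: comm_ring_1 mat"
  assumes A: "A \<in> carrier_mat n n" and r: "r < n" "\<And>j. j < n \<Longrightarrow> A $$ (r, j) = 0"
  shows "det A = 0"
  unfolding det_def'[OF A]
proof (intro sum.neutral ballI)
  fix p assume "p \<in> {p. p permutes {0..<n}}"
  then have "p r < n" using permutes_in_image[of p "{0..<n}" r] r(1) by simp
  then have "(\<Prod>i = 0..<n. A $$ (i, p i)) = 0" using r by (intro prod_zero bexI[of _ r]) auto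
  then show "signof p * (\<Prod>i = 0..<n. A $$ (i, p i)) = 0" by simp
qed

lemma det_submatrix_mat_diag:
  fixes d :: "nat \<Rightarrow> 'a :: comm_ring_1"
  assumes S: "S \<subseteq> {..<n}" and T: "T \<subseteq> {..<n}" and card: "card S = card T"
  shows "det (submatrix (mat_diag n d) S T) = (if S = T then \<Prod>i\<in>S. d i else 0)"
proof -
  let ?M = "submatrix (mat_diag n d) S T"
  have fin: "finite S" "finite T" using S T finite_subset by blast+
  note pickS = bij_betw_pick[OF fin(1)] and pickT = bij_betw_pick[OF fin(2)]
  have M: "?M \<in> carrier_mat (card S) (card S)"
    using submatrix_carrier[OF mat_diag_dim, of n d S T] S T card by (simp add: Int_absorb1)
  have nth: "?M $$ (i, j) = (if pick S i = pick T j then d (pick S i) else 0)"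
    if "i < card S" "j < card S" for i j
  proof -
    have "pick S i < n" "pick T j < n"
      using that card S T bij_betwE[OF pickS] bij_betwE[OF pickT] by fastforce+
    then show ?thesis
      using submatrix_nth[OF mat_diag_dim, of i n S j T d] that S T card
      by (simp add: Int_absorb1 mat_diag_def)
  qed
  show ?thesis
  proof (cases "S = T")
    case True
    have "?M = mat_diag (card S) (\<lambda>i. d (pick S i))"
      using M nth bij_betw_imp_inj_on[OF pickS] True
      by (intro eq_matI) (auto simp: mat_diag_def inj_on_eq_iff)
    then show ?thesis
      using True prod.reindex_bij_betw[OF pickS, of d]
      by (simp add: det_mat_diag atLeast0LessThan)
  next
    case False
    then obtain i where i: "i \<in> S" "i \<notin> T" using card_subset_eq[OF fin(2)] card by blast
    then obtain r where r: "r < card S" "pick S r = i"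
      using bij_betw_imp_surj_on[OF pickS] by (metis atLeastLessThan_iff imageE)
    have "pick T j \<noteq> i" if "j < card S" for j using bij_betwE[OF pickT] that card i(2) by auto
    then have "det ?M = 0" using nth[OF r(1)] r(2) by (intro det_zero_row[OF M r(1)]) metis
    then show ?thesis using False by simp
  qed
qed

lemma compound_mat_diag:
  "compound k (mat_diag n d) = mat_diag (n choose k) (\<lambda>a. \<Prod>i\<in>subset_enum n k a. d i)"
proof (rule eq_matI)
  fix a b
  assume "a < dim_row (mat_diag (n choose k) (\<lambda>a. \<Prod>i\<in>subset_enum n k a. d i))"
    "b < dim_col (mat_diag (n choose k) (\<lambda>a. \<Prod>i\<in>subset_enum n k a. d i))"
  then have ab: "a < n choose k" "b < n choose k" by (auto simp: mat_diag_def)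
  have "compound k (mat_diag n d) $$ (a, b) =
      det (submatrix (mat_diag n d) (subset_enum n k a) (subset_enum n k b))"
    using ab by (simp add: compound_def)
  also have "\<dots> = (if a = b then \<Prod>i\<in>subset_enum n k a. d i else 0)"
    using det_submatrix_mat_diag[OF subset_enum(1)[OF ab(1)] subset_enum(1)[OF ab(2)], of d] ab
    by (simp add: subset_enum(2)[OF ab(1)] subset_enum(2)[OF ab(2)] subset_enum_eq_iff)
  also have "\<dots> = mat_diag (n choose k) (\<lambda>a. \<Prod>i\<in>subset_enum n k a. d i) $$ (a, b)"
    using ab by (simp add: mat_diag_def)
  finally show "compound k (mat_diag n d) $$ (a, b) =
    mat_diag (n choose k) (\<lambda>a. \<Prod>i\<in>subset_enum n k a. d i) $$ (a, b)" .
qed (simp_all add: compound_def)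

lemma compound_one: "compound k (1\<^sub>m n :: 'a :: comm_ring_1 mat) = 1\<^sub>m (n choose k)"
  using compound_mat_diag[of k n "\<lambda>_. 1 :: 'a"] by simp

lemma spectral_decomp_compound:
  assumes "spectral_decomp n A U d"
  shows "spectral_decomp (n choose k) (compound k A) (compound k U) (\<lambda>a. \<Prod>i\<in>subset_enum n k a. d i)"
proof (rule spectral_decompI)
  note U = spectral_decompD[OF assms]
  show "compound k U \<in> carrier_mat (n choose k) (n choose k)" using U(1) by simp
  show "compound k U * mat_adjoint (compound k U) = 1\<^sub>m (n choose k)"
    "mat_adjoint (compound k U) * compound k U = 1\<^sub>m (n choose k)"
    using compound_mult[OF U(1,2), of k] compound_mult[OF U(2,1), of k] U(3,4)
    by (simp_all add: compound_one compound_mat_adjoint)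
  show "compound k A = compound k U * real_diag (n choose k) (\<lambda>a. \<Prod>i\<in>subset_enum n k a. d i) *
      mat_adjoint (compound k U)"
    unfolding U(5) using U(1,2)
    by (simp add: compound_mult[of _ n n _ n] square_mult_carrier compound_mat_adjoint
        compound_mat_diag)
qed

lemma posdef_compound:
  assumes "posdef n A"
  shows "posdef (n choose k) (compound k A)"
proof -
  obtain U d where A: "spectral_decomp n A U d" and d_pos: "\<And>i. i < n \<Longrightarrow> d i > 0"
    using posdef_spectral_decomp_powr[OF assms] by metis
  show ?thesis
    using subset_enum(1) d_pos
    by (intro spectral_decomp_posdef[OF spectral_decomp_compound[OF A]] prod_pos) blast
qed

lemma compound_mat_powr:
  assumes "posdef n A"
  shows "compound k (mat_powr A s) = mat_powr (compound k A) s"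
proof -
  obtain U d where A: "spectral_decomp n A U d" and d_pos: "\<And>i. i < n \<Longrightarrow> d i > 0"
    and powr: "\<And>s. spectral_decomp n (mat_powr A s) U (\<lambda>i. d i powr s)"
    using posdef_spectral_decomp_powr[OF assms] by metis
  have pos: "d i > 0" if "a < n choose k" "i \<in> subset_enum n k a" for a i
    using d_pos subset_enum(1) that by blast
  have "spectral_decomp (n choose k) (mat_powr (compound k A) s) (compound k U)
      (\<lambda>a. (\<Prod>i\<in>subset_enum n k a. d i) powr s)"
    using pos by (intro spectral_decomp_mat_powr[OF spectral_decomp_compound[OF A]] prod_pos) blast
  from spectral_decomp_unique[OF spectral_decomp_compound[OF powr] this] show ?thesis
    using pos by (simp add: prod_powr_distrib less_imp_le)
qed

lemma compound_sandwich:
  fixes H X :: "'a :: comm_ring_1 mat"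
  assumes "H \<in> carrier_mat n n" "X \<in> carrier_mat n n"
  shows "compound k (H * X * H) = compound k H * compound k X * compound k H"
  by (simp only: compound_mult[OF square_mult_carrier[OF assms] assms(1)] compound_mult[OF assms])

lemma prod_subset_le_prod_initial:
  fixes d :: "nat \<Rightarrow> 'a :: linordered_semidom"
  assumes antimono: "\<And>i j. i \<le> j \<Longrightarrow> j < n \<Longrightarrow> d j \<le> d i" and nonneg: "\<And>i. i < n \<Longrightarrow> d i \<ge> 0"
    and S: "S \<subseteq> {..<n}"
  shows "(\<Prod>i\<in>S. d i) \<le> (\<Prod>i<card S. d i)"
proof -
  have pick: "bij_betw (pick S) {0..<card S} S" using S finite_subset bij_betw_pick by blast
  have "(\<Prod>i\<in>S. d i) = (\<Prod>i<card S. d (pick S i))"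
    using prod.reindex_bij_betw[OF pick, of d] by (simp add: atLeast0LessThan)
  also have "\<dots> \<le> (\<Prod>i<card S. d i)"
  proof (rule prod_mono)
    fix i assume "i \<in> {..<card S}"
    moreover from this have "pick S i < n" using bij_betwE[OF pick] S by auto
    ultimately show "0 \<le> d (pick S i) \<and> d (pick S i) \<le> d i"
      using antimono nonneg le_pick[of i S] by simp
  qed
  finally show ?thesis .
qed

lemma loewner_le_compound_iff_prod_eigs_le:
  assumes X: "posdef n X" and k: "k \<le> n"
  shows "loewner_le (n choose k) (compound k X) (complex_of_real c \<cdot>\<^sub>m 1\<^sub>m (n choose k)) \<longleftrightarrow>
    (\<Prod>j<k. eigs X ! j) \<le> c"
proof -
  obtain U where U: "spectral_decomp n X U ((!) (eigs X))" and pos: "\<And>i. i < n \<Longrightarrow> eigs X ! i > 0"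
    using posdef_spectral_decomp_eigs[OF X] by blast
  have "(\<Prod>i\<in>subset_enum n k a. eigs X ! i) \<le> (\<Prod>j<k. eigs X ! j)" if "a < n choose k" for a
    using prod_subset_le_prod_initial[OF eigs_antimono[OF posdefD(1,2)[OF X]] less_imp_le[OF pos]
        subset_enum(1)[OF that]]
    by (simp add: subset_enum(2)[OF that])
  moreover have "{..<k} \<in> subset_enum n k ` {..<n choose k}"
    unfolding bij_betw_imp_surj_on[OF bij_betw_subset_enum] using k by auto
  then obtain a where "a < n choose k" "subset_enum n k a = {..<k}" by auto
  ultimately show ?thesis
    unfolding loewner_le_smult_one_iff[OF spectral_decomp_compound[OF U]] by (metis order_trans)
qed

section \<open>Log-majorization\<close>

lemma loewner_le_riccati_improve:
  assumes A: "posdef n A" and C: "posdef n C" and s: "0 \<le> s" "s \<le> 1" and "c > 0" "\<mu> > 0"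
    and AC: "loewner_le n A (complex_of_real c \<cdot>\<^sub>m mat_powr C (2 * s))"
    and AB: "loewner_le n (mat_powr A (1 + s)) (complex_of_real \<mu> \<cdot>\<^sub>m mat_powr (C * A * C) s)"
  shows "loewner_le n A (complex_of_real ((\<mu> * c powr s) powr (1 / (1 + s))) \<cdot>\<^sub>m mat_powr C (2 * s))"
proof -
  have B: "posdef n (C * A * C)" by (rule posdef_congruence[OF C A])
  have "C * mat_powr C (2 * s) * C = mat_powr C (2 + 2 * s)"
    using powr_sandwich_mat_powr[OF C, of 1 "2 * s"] by (simp add: mat_powr_one[OF C])
  then have "loewner_le n (C * A * C) (complex_of_real c \<cdot>\<^sub>m mat_powr C (2 + 2 * s))"
    using loewner_le_smult_congruence[OF AC posdefD(1)[OF A] mat_powr_carrier[OF C] C] by simp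
  from loewner_heinz_smult[OF B posdef_mat_powr[OF C] this \<open>c > 0\<close> s]
  have "loewner_le n (mat_powr (C * A * C) s)
      (complex_of_real (c powr s) \<cdot>\<^sub>m mat_powr C ((2 + 2 * s) * s))"
    by (simp only: mat_powr_mat_powr[OF C])
  from loewner_le_smult[OF this mat_powr_carrier[OF B] mat_powr_carrier[OF C] less_imp_le[OF \<open>\<mu> > 0\<close>]]
  have "loewner_le n (complex_of_real \<mu> \<cdot>\<^sub>m mat_powr (C * A * C) s)
      (complex_of_real (\<mu> * c powr s) \<cdot>\<^sub>m mat_powr C ((2 + 2 * s) * s))" .
  from loewner_le_trans[OF AB this]
  have "loewner_le n (mat_powr (mat_powr A (1 + s)) (1 / (1 + s)))
      (complex_of_real ((\<mu> * c powr s) powr (1 / (1 + s))) \<cdot>\<^sub>m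
        mat_powr (mat_powr C ((2 + 2 * s) * s)) (1 / (1 + s)))"
    using \<open>c > 0\<close> \<open>\<mu> > 0\<close> s by (intro loewner_heinz_smult posdef_mat_powr A C) (auto simp: field_simps)
  moreover have "(2 + 2 * s) * s * (1 / (1 + s)) = 2 * s" "(1 + s) * (1 / (1 + s)) = 1"
    using s by (simp_all add: field_simps)
  ultimately show ?thesis
    by (simp only: mat_powr_mat_powr[OF A] mat_powr_mat_powr[OF C] mat_powr_one[OF A])
qed

lemma le_if_le_weighted_geometric_mean:
  fixes c \<mu> s :: real
  assumes "c > 0" "\<mu> > 0" "s \<ge> 0" "c \<le> (\<mu> * c powr s) powr (1 / (1 + s))"
  shows "c \<le> \<mu>"
proof -
  have "c powr (1 + s) \<le> ((\<mu> * c powr s) powr (1 / (1 + s))) powr (1 + s)"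
    using assms by (intro powr_mono2) auto
  also have "\<dots> = \<mu> * c powr s" using assms by (simp add: powr_powr)
  finally show ?thesis using \<open>c > 0\<close> by (simp add: powr_add)
qed

lemma loewner_le_powr_sandwich_iff:
  assumes B: "posdef n B" and X: "X \<in> carrier_mat n n"
  shows "loewner_le n (powr_sandwich B (- a) X) (complex_of_real c \<cdot>\<^sub>m 1\<^sub>m n) \<longleftrightarrow>
    loewner_le n X (complex_of_real c \<cdot>\<^sub>m mat_powr B (2 * a))"
proof
  have "powr_sandwich B (- a) X \<in> carrier_mat n n"
    using X mat_powr_carrier[OF B] by (simp add: square_mult_carrier)
  moreover assume "loewner_le n (powr_sandwich B (- a) X) (complex_of_real c \<cdot>\<^sub>m 1\<^sub>m n)"
  ultimately show "loewner_le n X (complex_of_real c \<cdot>\<^sub>m mat_powr B (2 * a))"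
    using loewner_le_smult_congruence[of n _ c, OF _ _ one_carrier_mat posdef_mat_powr[OF B, of a]]
      powr_sandwich_cancel[OF B X, of a "- a"] powr_sandwich_one[OF B, of a] by fastforce
next
  assume "loewner_le n X (complex_of_real c \<cdot>\<^sub>m mat_powr B (2 * a))"
  from loewner_le_smult_congruence[OF this X mat_powr_carrier[OF B] posdef_mat_powr[OF B, of "- a"]]
  show "loewner_le n (powr_sandwich B (- a) X) (complex_of_real c \<cdot>\<^sub>m 1\<^sub>m n)"
    by (simp add: powr_sandwich_mat_powr[OF B] mat_powr_zero[OF B])
qed

text \<open>The largest eigenvalue \<open>c\<close> of \<open>C\<^sup>-\<^sup>s A C\<^sup>-\<^sup>s\<close> is the least constant with \<open>A \<le> c C\<^bsup>2s\<^esup>\<close>, so the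
  improved constant is not smaller.\<close>

lemma loewner_le_powr_sandwich_riccati:
  assumes A: "posdef n A" and C: "posdef n C" and s: "0 \<le> s" "s \<le> 1" and "\<mu> > 0"
    and bound: "loewner_le n (powr_sandwich (C * A * C) (- (s / 2)) (mat_powr A (1 + s)))
      (complex_of_real \<mu> \<cdot>\<^sub>m 1\<^sub>m n)"
  shows "loewner_le n (powr_sandwich C (- s) A) (complex_of_real \<mu> \<cdot>\<^sub>m 1\<^sub>m n)"
proof -
  have AB: "loewner_le n (mat_powr A (1 + s)) (complex_of_real \<mu> \<cdot>\<^sub>m mat_powr (C * A * C) s)"
    using bound loewner_le_powr_sandwich_iff[OF posdef_congruence[OF C A] mat_powr_carrier[OF A],
        of "s / 2" "1 + s" \<mu>]
    by simp
  define M where "M = powr_sandwich C (- s) A"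
  have M: "posdef n M" unfolding M_def by (rule posdef_powr_sandwich[OF C A])
  obtain U where U: "spectral_decomp n M U ((!) (eigs M))" and pos: "\<And>i. i < n \<Longrightarrow> eigs M ! i > 0"
    using posdef_spectral_decomp_eigs[OF M] by blast
  have eigs_le_iff: "(\<forall>i<n. eigs M ! i \<le> r) \<longleftrightarrow>
      loewner_le n A (complex_of_real r \<cdot>\<^sub>m mat_powr C (2 * s))" for r
    using loewner_le_smult_one_iff[OF U, of r]
      loewner_le_powr_sandwich_iff[OF C posdefD(1)[OF A], of s r]
    by (simp add: M_def)
  have "eigs M ! i \<le> \<mu>" if i: "i < n" for i
  proof -
    define c where "c = eigs M ! 0"
    have "c > 0" using pos i by (simp add: c_def)
    have eigs_le_c: "\<forall>j<n. eigs M ! j \<le> c"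
      using eigs_antimono[OF posdefD(1,2)[OF M]] by (simp add: c_def)
    then have "loewner_le n A (complex_of_real c \<cdot>\<^sub>m mat_powr C (2 * s))" by (simp only: eigs_le_iff)
    from loewner_le_riccati_improve[OF A C s \<open>c > 0\<close> \<open>\<mu> > 0\<close> this AB]
    have "\<forall>j<n. eigs M ! j \<le> (\<mu> * c powr s) powr (1 / (1 + s))" by (simp only: eigs_le_iff)
    then have "c \<le> (\<mu> * c powr s) powr (1 / (1 + s))" using i by (auto simp: c_def)
    then have "c \<le> \<mu>" by (rule le_if_le_weighted_geometric_mean[OF \<open>c > 0\<close> \<open>\<mu> > 0\<close> s(1)])
    then show ?thesis using eigs_le_c i by force
  qed
  then show ?thesis using loewner_le_smult_one_iff[OF U] by (simp add: M_def)
qed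

lemma prod_eigs_powr_sandwich_le:
  assumes A: "posdef n A" and C: "posdef n C" and s: "0 \<le> s" "s \<le> 1" and k: "k \<le> n"
  shows "(\<Prod>j<k. eigs (powr_sandwich C (- s) A) ! j) \<le>
    (\<Prod>j<k. eigs (powr_sandwich (C * A * C) (- (s / 2)) (mat_powr A (1 + s))) ! j)"
proof -
  let ?X = "powr_sandwich C (- s) A"
  let ?Y = "powr_sandwich (C * A * C) (- (s / 2)) (mat_powr A (1 + s))"
  have B: "posdef n (C * A * C)" by (rule posdef_congruence[OF C A])
  have Y: "posdef n ?Y" by (intro posdef_powr_sandwich B posdef_mat_powr A)
  define \<mu> where "\<mu> = (\<Prod>j<k. eigs ?Y ! j)"
  have "\<mu> > 0"
    unfolding \<mu>_def using posdef_spectral_decomp_eigs[OF Y] k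
    by (intro prod_pos) (metis lessThan_iff less_le_trans)
  have "compound k ?X = powr_sandwich (compound k C) (- s) (compound k A)"
    by (simp only: compound_sandwich[OF mat_powr_carrier[OF C] posdefD(1)[OF A]]
        compound_mat_powr[OF C])
  moreover have "compound k ?Y = powr_sandwich (compound k C * compound k A * compound k C) (- (s / 2))
      (mat_powr (compound k A) (1 + s))"
    by (simp only: compound_sandwich[OF mat_powr_carrier[OF B] mat_powr_carrier[OF A]]
        compound_mat_powr[OF A] compound_mat_powr[OF B]
        compound_sandwich[OF posdefD(1)[OF C] posdefD(1)[OF A]])
  moreover have "loewner_le (n choose k) (compound k ?Y) (complex_of_real \<mu> \<cdot>\<^sub>m 1\<^sub>m (n choose k))"
    unfolding loewner_le_compound_iff_prod_eigs_le[OF Y k] by (simp add: \<mu>_def)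
  ultimately have "loewner_le (n choose k) (compound k ?X) (complex_of_real \<mu> \<cdot>\<^sub>m 1\<^sub>m (n choose k))"
    using loewner_le_powr_sandwich_riccati[OF posdef_compound[OF A] posdef_compound[OF C] s \<open>\<mu> > 0\<close>]
    by simp
  then show ?thesis
    unfolding loewner_le_compound_iff_prod_eigs_le[OF posdef_powr_sandwich[OF C A] k] \<mu>_def .
qed

lemma det_sandwich:
  fixes H X :: "'a :: comm_ring_1 mat"
  assumes "H \<in> carrier_mat n n" "X \<in> carrier_mat n n"
  shows "det (H * X * H) = det H * det X * det H"
  by (simp only: det_mult[OF square_mult_carrier[OF assms] assms(1)] det_mult[OF assms])

lemma det_powr_sandwich:
  assumes "posdef n A" "X \<in> carrier_mat n n"
  shows "det (powr_sandwich A s X) = complex_of_real (Re (det A) powr (2 * s)) * det X"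
  unfolding det_sandwich[OF mat_powr_carrier[OF assms(1)] assms(2)] posdef_det(3)[OF assms(1)]
    mult_2 powr_add
  by simp

lemma det_powr_sandwich_riccati:
  assumes A: "posdef n A" and C: "posdef n C"
  shows "det (powr_sandwich C (- s) A) =
    det (powr_sandwich (C * A * C) (- (s / 2)) (mat_powr A (1 + s)))"
proof -
  define a where "a = Re (det A)"
  define c where "c = Re (det C)"
  have a: "a > 0" "det A = complex_of_real a" and c: "c > 0" "det C = complex_of_real c"
    using posdef_det(1,2)[OF A] posdef_det(1,2)[OF C] by (simp_all add: a_def c_def)
  have det_B: "Re (det (C * A * C)) = c * a * c"
    unfolding det_sandwich[OF posdefD(1)[OF C] posdefD(1)[OF A]] by (simp add: a c)
  have "(c * a * c) powr (2 * - (s / 2)) = c powr - s * a powr - s * c powr - s"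
    using a(1) c(1) by (simp add: powr_mult)
  moreover have "a powr - s * a powr (1 + s) = a" "c powr (2 * - s) = c powr - s * c powr - s"
    using a(1) by (simp_all flip: powr_add)
  ultimately have "c powr (2 * - s) * a = (c * a * c) powr (2 * - (s / 2)) * a powr (1 + s)"
    by (simp add: ac_simps)
  then show ?thesis
    unfolding det_powr_sandwich[OF C posdefD(1)[OF A]] posdef_det(3)[OF A]
      det_powr_sandwich[OF posdef_congruence[OF C A] mat_powr_carrier[OF A]] det_B a(2)
    by (simp add: c_def[symmetric] flip: of_real_mult)
qed

theorem log_majorized_powr_sandwich:
  assumes "posdef n A" "posdef n C" "0 \<le> s" "s \<le> 1"
  shows "log_majorized (powr_sandwich C (- s) A)
    (powr_sandwich (C * A * C) (- (s / 2)) (mat_powr A (1 + s)))"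
proof -
  have "dim_row (powr_sandwich C (- s) A) = n"
    using posdefD(1)[OF posdef_powr_sandwich[OF assms(2,1)]] by blast
  then show ?thesis
    unfolding log_majorized_def
    using prod_eigs_powr_sandwich_le[OF assms] det_powr_sandwich_riccati[OF assms(1,2)] by auto
qed

lemma log_majorized_similar:
  assumes "similar_mat Y Z"
  shows "log_majorized X Y \<longleftrightarrow> log_majorized X Z"
proof -
  have "dim_row Y = dim_row Z" using similar_matD[OF assms] by auto
  then have "eigs Y = eigs Z" using char_poly_similar[OF assms] by (simp add: eigs_def)
  then show ?thesis using det_similar[OF assms] by (simp add: log_majorized_def)
qed

lemma similar_mat_mult_commute:
  fixes X Y Z :: "'a :: semiring_1 mat"
  assumes "X \<in> carrier_mat n n" "Y \<in> carrier_mat n n" "Z \<in> carrier_mat n n"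
    and "X * Z = 1\<^sub>m n" "Z * X = 1\<^sub>m n"
  shows "similar_mat (X * Y) (Y * X)"
proof (rule similar_matI)
  have "X * (Y * X) * Z = (X * Y) * (X * Z)" using assms(1-3) by (simp add: square_mult[where n = n])
  then show "X * Y = X * (Y * X) * Z" using assms by (simp add: square_mult_carrier)
qed (use assms in \<open>auto simp: square_mult_carrier\<close>)

lemma similar_mat_powr_sandwich_commute:
  assumes A: "posdef n A" and B: "posdef n B"
  shows "similar_mat (powr_sandwich A (a / 2) (mat_powr B b)) (powr_sandwich B (b / 2) (mat_powr A a))"
proof -
  define P where "P r = mat_powr A (r * a / 2)" for r
  define Q where "Q r = mat_powr B (r * b / 2)" for r
  have carrier: "P r \<in> carrier_mat n n" "Q r \<in> carrier_mat n n" for r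
    by (simp_all add: P_def Q_def mat_powr_carrier[OF A] mat_powr_carrier[OF B])
  have inverse: "P r * P (- r) = 1\<^sub>m n" "Q r * Q (- r) = 1\<^sub>m n" for r
    by (simp_all add: P_def Q_def mat_powr_add[OF A] mat_powr_add[OF B] mat_powr_zero[OF A]
        mat_powr_zero[OF B])
  have cancel: "P r * (P (- r) * X) = X" "Q r * (Q (- r) * X) = X" if "X \<in> carrier_mat n n" for r X
    using that carrier by (simp_all add: inverse flip: square_mult_assoc[where n = n])
  have "similar_mat ((P 1 * Q 1) * (Q 1 * P 1)) ((Q 1 * P 1) * (P 1 * Q 1))"
  proof (rule similar_mat_mult_commute)
    show "(P 1 * Q 1) * (Q (- 1) * P (- 1)) = 1\<^sub>m n"
      using carrier by (simp add: square_mult[where n = n] cancel inverse)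
    show "(Q (- 1) * P (- 1)) * (P 1 * Q 1) = 1\<^sub>m n"
      using carrier cancel[of _ "- 1"] inverse[of "- 1"] by (simp add: square_mult[where n = n])
  qed (use carrier in \<open>auto intro: square_mult_carrier\<close>)
  moreover have "mat_powr A a = P 1 * P 1" "mat_powr B b = Q 1 * Q 1"
    by (simp_all add: P_def Q_def mat_powr_add[OF A] mat_powr_add[OF B])
  ultimately show ?thesis
    using carrier[of 1] by (simp add: square_mult[where n = n] P_def Q_def)
qed

lemma geo_mean_riccati:
  assumes P: "posdef n P" and B: "posdef n B"
  shows "posdef n (geo_mean P B)" "geo_mean P B * mat_powr P (- 1) * geo_mean P B = B"
proof -
  define Z where "Z = powr_sandwich P (- 1 / 2) B"
  have Z: "posdef n Z" unfolding Z_def by (rule posdef_powr_sandwich[OF P B])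
  let ?R = "mat_powr P (1 / 2)" and ?S = "mat_powr Z (1 / 2)"
  have mean: "geo_mean P B = ?R * ?S * ?R" by (simp add: geo_mean_def Z_def)
  show "posdef n (geo_mean P B)"
    unfolding mean by (rule posdef_powr_sandwich[OF P posdef_mat_powr[OF Z]])
  have "geo_mean P B * mat_powr P (- 1) * geo_mean P B =
      ?R * (?S * (?R * mat_powr P (- 1) * ?R) * ?S) * ?R"
    unfolding mean using mat_powr_carrier[OF P] mat_powr_carrier[OF Z]
    by (simp add: square_mult[where n = n])
  also have "?R * mat_powr P (- 1) * ?R = 1\<^sub>m n"
    using powr_sandwich_mat_powr[OF P, of "1 / 2" "- 1"] mat_powr_zero[OF P] by simp
  also have "?S * 1\<^sub>m n * ?S = Z"
    using powr_sandwich_one[OF Z, of "1 / 2"] mat_powr_one[OF Z] by simp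
  also have "?R * Z * ?R = B"
    unfolding Z_def using posdefD(1)[OF B] by (intro powr_sandwich_cancel[OF P]) simp_all
  finally show "geo_mean P B * mat_powr P (- 1) * geo_mean P B = B" .
qed

lemma geo_mean_mat_inv_riccati:
  assumes A: "posdef n A" and B: "posdef n B"
  defines "C \<equiv> geo_mean (mat_inv A) B"
  shows "posdef n C" "C * A * C = B"
  using geo_mean_riccati[OF posdef_mat_powr[OF A, of "- 1"] B]
  unfolding C_def mat_inv_eq_mat_powr[OF A]
  by (simp_all add: mat_powr_mat_powr[OF A] mat_powr_one[OF A])

lemma powr_sandwich_riccati_inverse:
  assumes C: "posdef n C" and A: "A \<in> carrier_mat n n"
  defines "B \<equiv> C * A * C" and "D \<equiv> mat_powr C (- 1)"
  shows "D * B * D = A" "powr_sandwich D s B = powr_sandwich C (1 - s) A"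
proof -
  have B: "B = powr_sandwich C 1 A" by (simp add: B_def mat_powr_one[OF C])
  show "D * B * D = A" unfolding B D_def by (rule powr_sandwich_cancel[OF C A]) simp
  show "powr_sandwich D s B = powr_sandwich C (1 - s) A"
    unfolding B D_def mat_powr_mat_powr[OF C] powr_sandwich_powr_sandwich[OF C A] by simp
qed

corollary log_majorized_powr_sandwich_inverse:
  assumes A: "posdef n A" and C: "posdef n C" and s: "0 \<le> s" "s \<le> 1"
  shows "log_majorized (powr_sandwich C (1 + s) A) (powr_sandwich A (- (s / 2)) (mat_powr (C * A * C) (1 + s)))"
proof -
  define B where "B = C * A * C"
  define D where "D = mat_powr C (- 1)"
  have "posdef n B" "posdef n D"
    unfolding B_def D_def by (rule posdef_congruence[OF C A] posdef_mat_powr[OF C])+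
  from log_majorized_powr_sandwich[OF this s] show ?thesis
    using powr_sandwich_riccati_inverse[OF C posdefD(1)[OF A]] by (simp add: B_def D_def)
qed

theorem theorem4p3:
  fixes A B :: "complex mat" and n :: nat and t :: real
  assumes "A \<in> carrier_mat n n" and "B \<in> carrier_mat n n"
    and "pos_def_mat A" and "pos_def_mat B"
    and "t \<in> {-1/2..0} \<union> {1..3/2}"
  shows "log_majorized (sp_hat t A B)
           (mat_powr A ((1 - t) / 2) * mat_powr B t * mat_powr A ((1 - t) / 2))"
proof -
  have A: "posdef n A" and B: "posdef n B" using assms by (simp_all add: posdef_def)
  define C where "C = geo_mean (mat_inv A) B"
  note C = geo_mean_mat_inv_riccati[OF A B, folded C_def]
  have sp_hat: "sp_hat t A B = powr_sandwich C t A" by (simp add: sp_hat_def C_def)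
  consider "-1/2 \<le> t" "t \<le> 0" | "1 \<le> t" "t \<le> 3/2" using assms(5) by auto
  then show ?thesis
  proof cases
    case 1
    have "log_majorized (sp_hat t A B) (powr_sandwich B (t / 2) (mat_powr A (1 - t)))"
      using log_majorized_powr_sandwich[OF A C(1), of "- t"] 1 by (simp add: sp_hat C(2))
    then show ?thesis
      using log_majorized_similar[OF similar_mat_powr_sandwich_commute[OF A B]] by blast
  next
    case 2
    have "log_majorized (sp_hat t A B) (powr_sandwich A (- ((t - 1) / 2)) (mat_powr B t))"
      using log_majorized_powr_sandwich_inverse[OF A C(1), of "t - 1"] 2 by (simp add: sp_hat C(2))
    moreover have "- ((t - 1) / 2) = (1 - t) / 2" by (simp add: field_simps)
    ultimately show ?thesis by (simp only:)
  qed
qed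

end
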